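(* Let $\mu=-9.5$ and $\beta=0.3$. For every $\xi\in[1.01,\,1.125]$, the Hénon-like map $f:\mathbb{R}^3\to\mathbb{R}^3$, $$f(\mathrm{x},\mathrm{y},\mathrm{z})=\left(\mathrm{y},\ \mu+\mathrm{y}^2+\beta\,\mathrm{x},\ \xi\,\mathrm{z}+\mathrm{y}\right),$$ has a blender, namely a $2$-blender: there exists an invariant transitive hyperbolic set $\Lambda\subset\mathbb{R}^3$ of $f$ that is a $2$-blender.
   Context: A set $\Lambda\subset\mathbb{R}^n$ is hyperbolic for a diffeomorphism $f$ if for every $p\in\Lambda$ the tangent space at $p$ splits as $E^u_p\oplus E^s_p$, this splitting is invariant under $Df$, and there are $c>0$, $\lambda\in(0,1)$ independent of $p$ with $\|Df^{-j}(p)v_u\|<c\lambda^j\|v_u\|$ and $\|Df^{j}(p)v_s\|<c\lambda^j\|v_s\|$ for all $j\ge1$ and nonzero $v_u\in E^u_p$, $v_s\in E^s_p$. For a given neighbourhood $U$ of a hyperbolic set $\Lambda$, the local stable manifold of $\Lambda$ in $U$ is $W^s_{\mathrm{loc}}(\Lambda)=\bigcup_{p\in\Lambda}W^s_{p,\mathrm{loc}}$, where $W^s_{p,\mathrm{loc}}=\{q: \|f^j(p)-f^j(q)\|\to0 \text{ as } j\to\infty,\ f^{j}(q)\in U \text{ for all } j\ge0\}$. For a diffeomorphism $g$ near $f$ and the hyperbolic continuation $\Lambda_g$ of $\Lambda$, $W^s_{\mathrm{loc}}(\Lambda_g)$ is defined in the same way using $g$. $k$-blender. Let $\Lambda\subset\mathbb{R}^n$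 be an invariant transitive hyperbolic set of $f$ with $d_s$-dimensional stable fibres. For $k\in\mathbb{N}$ with $k>d_s$, $\Lambda$ is a $k$-blender if there are a $C^1$-neighbourhood $\mathcal{U}$ of $f$ and a (non-empty) $C^1$-open set $\mathcal{S}$ of embeddings of $(n-k)$-dimensional disks into $\mathbb{R}^n$ such that for every diffeomorphism $g\in\mathcal{U}$, every continuation $\Lambda_g$ of $\Lambda$, and every $S\in\mathcal{S}$, $S\cap W^s_{\mathrm{loc}}(\Lambda_g)\ne\emptyset$. *)

theory Defs
  imports "HOL-Analysis.Analysis"
begin

section \<open>The C1 topology\<close>

(* For S = UNIV the filter "at x within S" is "at x". On a closed ball the derivative within the
   ball is uniquely determined, also at boundary points. *)
definition C1_on :: "'a::euclidean_space set \<Rightarrow> ('a \<Rightarrow> 'b::euclidean_space) \<Rightarrow> bool" where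
  "C1_on S f \<longleftrightarrow> (\<exists>f' :: 'a \<Rightarrow> 'a \<Rightarrow>\<^sub>L 'b.
     (\<forall>x\<in>S. (f has_derivative blinfun_apply (f' x)) (at x within S)) \<and> continuous_on S f')"

definition C1_close ::
  "'a::euclidean_space set \<Rightarrow> 'a set \<Rightarrow> real \<Rightarrow> ('a \<Rightarrow> 'b::euclidean_space) \<Rightarrow> ('a \<Rightarrow> 'b) \<Rightarrow> bool" where
  "C1_close S K \<epsilon> f g \<longleftrightarrow> (\<forall>x\<in>K. norm (f x - g x) < \<epsilon> \<and>
     onorm (\<lambda>v. frechet_derivative f (at x within S) v - frechet_derivative g (at x within S) v) < \<epsilon>)"

(* Openness in the class X of C1 maps on S, for the topology of C1 convergence on compact subsets
   of S. For compact S this is the uniform C1 topology. For S = UNIV it is coarser than the uniform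
   and the strong (Whitney) C1 topologies, so neighbourhoods in it are neighbourhoods in those. *)
definition C1_open ::
  "'a::euclidean_space set \<Rightarrow> ('a \<Rightarrow> 'b::euclidean_space) set \<Rightarrow> ('a \<Rightarrow> 'b) set \<Rightarrow> bool" where
  "C1_open S X \<U> \<longleftrightarrow> \<U> \<subseteq> X \<and>
     (\<forall>f\<in>\<U>. \<exists>K \<epsilon>. compact K \<and> K \<subseteq> S \<and> \<epsilon> > 0 \<and> (\<forall>g\<in>X. C1_close S K \<epsilon> f g \<longrightarrow> g \<in> \<U>))"

definition diffeos :: "('a::euclidean_space \<Rightarrow> 'a) set" where
  "diffeos = {f. bij f \<and> C1_on UNIV f \<and> C1_on UNIV (inv f)}"

(* An injective immersion of the compact disk is a homeomorphism onto its image. Only the values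
   on the closed unit ball matter. *)
definition disk_embeddings :: "('d::euclidean_space \<Rightarrow> 'a::euclidean_space) set" where
  "disk_embeddings = {e. C1_on (cball 0 1) e \<and> inj_on e (cball 0 1) \<and>
     (\<forall>x\<in>cball 0 1. inj (frechet_derivative e (at x within cball 0 1)))}"


section \<open>Hyperbolic sets\<close>

definition hyperbolic_splitting ::
  "('a::euclidean_space \<Rightarrow> 'a) \<Rightarrow> 'a set \<Rightarrow> ('a \<Rightarrow> 'a set) \<Rightarrow> ('a \<Rightarrow> 'a set) \<Rightarrow> bool" where
  "hyperbolic_splitting f \<Lambda> Eu Es \<longleftrightarrow>
     (\<forall>p\<in>\<Lambda>. subspace (Eu p) \<and> subspace (Es p) \<and> Eu p \<inter> Es p = {0} \<and>
        {u + s |u s. u \<in> Eu p \<and> s \<in> Es p} = UNIV \<and>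
        frechet_derivative f (at p) ` Eu p = Eu (f p) \<and>
        frechet_derivative f (at p) ` Es p = Es (f p)) \<and>
     (\<exists>c r. c > 0 \<and> 0 < r \<and> r < 1 \<and>
        (\<forall>p\<in>\<Lambda>. \<forall>j\<ge>1.
           (\<forall>v\<in>Eu p - {0}. norm (frechet_derivative (inv f ^^ j) (at p) v) < c * r ^ j * norm v) \<and>
           (\<forall>v\<in>Es p - {0}. norm (frechet_derivative (f ^^ j) (at p) v) < c * r ^ j * norm v)))"

(* As usual, hyperbolic sets are compact and invariant; this is also what makes the
   hyperbolic continuation exist for every nearby diffeomorphism. *)
definition hyperbolic_set :: "('a::euclidean_space \<Rightarrow> 'a) \<Rightarrow> 'a set \<Rightarrow> bool" where
  "hyperbolic_set f \<Lambda> \<longleftrightarrow> compact \<Lambda> \<and> f ` \<Lambda> = \<Lambda> \<and> (\<exists>Eu Es. hyperbolic_splitting f \<Lambda> Eu Es)"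

definition transitive_set :: "('a::topological_space \<Rightarrow> 'a) \<Rightarrow> 'a set \<Rightarrow> bool" where
  "transitive_set f \<Lambda> \<longleftrightarrow> (\<exists>x\<in>\<Lambda>. \<Lambda> \<subseteq> closure {(f ^^ j) x |j. True})"

definition stable_dim :: "('a::euclidean_space \<Rightarrow> 'a) \<Rightarrow> 'a set \<Rightarrow> nat \<Rightarrow> bool" where
  "stable_dim f \<Lambda> d \<longleftrightarrow> (\<exists>Eu Es. hyperbolic_splitting f \<Lambda> Eu Es \<and> (\<forall>p\<in>\<Lambda>. dim (Es p) = d))"

(* The set conjugate to \<Lambda> by a homeomorphism that is \<delta>-close to the identity. By structural
   stability of hyperbolic sets, for every \<delta> > 0 it exists for all g close enough to f, and it is
   unique if \<delta> is small. *)
definition hyperbolic_continuation ::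
  "real \<Rightarrow> ('a::euclidean_space \<Rightarrow> 'a) \<Rightarrow> 'a set \<Rightarrow> ('a \<Rightarrow> 'a) \<Rightarrow> 'a set \<Rightarrow> bool" where
  "hyperbolic_continuation \<delta> f \<Lambda> g \<Lambda>g \<longleftrightarrow> hyperbolic_set g \<Lambda>g \<and>
     (\<exists>h h'. homeomorphism \<Lambda> \<Lambda>g h h' \<and> (\<forall>x\<in>\<Lambda>. h (f x) = g (h x) \<and> dist (h x) x < \<delta>))"

definition W_s_loc :: "('a::euclidean_space \<Rightarrow> 'a) \<Rightarrow> 'a set \<Rightarrow> 'a set \<Rightarrow> 'a set" where
  "W_s_loc f U \<Lambda> = (\<Union>p\<in>\<Lambda>. {q. (\<lambda>j. norm ((f ^^ j) p - (f ^^ j) q)) \<longlonglongrightarrow> 0 \<and>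
     (\<forall>j. (f ^^ j) q \<in> U)})"


section \<open>Blenders\<close>

(* The type 'd supplies the (n - k)-dimensional disk, n = DIM('a). The neighbourhood V in which
   local stable manifolds are taken is arbitrary; \<delta>, \<U> and \<S> may depend on it. *)
definition k_blender ::
  "'d::euclidean_space itself \<Rightarrow> nat \<Rightarrow> ('a::euclidean_space \<Rightarrow> 'a) \<Rightarrow> 'a set \<Rightarrow> bool" where
  "k_blender TYPE('d) k f \<Lambda> \<longleftrightarrow>
     DIM('d) + k = DIM('a) \<and> f \<in> diffeos \<and>
     hyperbolic_set f \<Lambda> \<and> transitive_set f \<Lambda> \<and> (\<exists>d\<^sub>s < k. stable_dim f \<Lambda> d\<^sub>s) \<and>
     (\<forall>V. open V \<and> \<Lambda> \<subseteq> V \<longrightarrow>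
       (\<exists>\<delta>>0. \<exists>\<U> \<S>.
          C1_open UNIV diffeos \<U> \<and> f \<in> \<U> \<and>
          C1_open (cball 0 1) disk_embeddings \<S> \<and> \<S> \<noteq> {} \<and>
          (\<forall>g\<in>\<U>. \<forall>\<Lambda>g. hyperbolic_continuation \<delta> f \<Lambda> g \<Lambda>g \<longrightarrow>
             (\<forall>S\<in>\<S>. (S :: 'd \<Rightarrow> 'a) ` cball 0 1 \<inter> W_s_loc g V \<Lambda>g \<noteq> {}))))"

definition henon_like :: "real \<Rightarrow> real \<Rightarrow> real \<Rightarrow> real ^ 3 \<Rightarrow> real ^ 3" where
  "henon_like \<mu> \<beta> \<xi> v = vector [v $ 2, \<mu> + (v $ 2)\<^sup>2 + \<beta> * v $ 1, \<xi> * v $ 3 + v $ 2]"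

end

theory Submission
  imports Defs "HOL-Library.Discrete_Functions" "HOL-Library.Nat_Bijection"
begin

text \<open>Write points as \<open>(x, y, z)\<close>. The third coordinate does not influence the first two, which form a Henon map with a full horseshoe: points
with bounded orbit satisfy \<open>2 < |y| < 4\<close>, and the sign of \<open>y\<close> codes the dynamics by a full shift on two symbols. The third coordinate is
expanded weakly, by \<open>\<xi> > 1\<close>. So the set \<open>\<Lambda>\<close> of points whose full orbit stays in a box is compact, invariant, transitive and
hyperbolic, with stable direction of dimension one: the stable and unstable spaces are the tangent vectors with bounded forward and backward orbits.
Every code is realised, by a contraction argument (\<open>itinerary_exists\<close>); codes are unique, because orbits with the
same code approach each other (\<open>same_itinerary_contracts\<close>).

The blender property has a covering argument at its heart. Consider a curve that crosses the strip \<open>|y| \<le> 4\<close> in the strong unstable direction,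
that is, almost tangent to the unstable direction of the Henon map. Its image crosses the strip twice, once for each sign
of \<open>y\<close>, and the two crossings are displaced in \<open>z\<close> to opposite sides. As \<open>\<xi>\<close> is close to 1, one of them always stays within \<open>|z| \<le> 8\<close> at \<open>y = 0\<close>
(\<open>admissible_image\<close>). By iteration and compactness the curve contains a point \<open>q\<close> whose forward orbit stays bounded and on strips with \<open>|y| \<ge> 2\<close>
(\<open>admissible_orbit\<close>). All of this uses only that the map is \<open>C\<^sup>1\<close>-close to \<open>f\<close>, so it holds for perturbations \<open>g\<close>.

A continuation of \<open>\<Lambda>\<close> for \<open>g\<close> is the image of \<open>\<Lambda>\<close> under a conjugacy \<open>h\<close> close to the identity. If \<open>x\<close> in \<open>\<Lambda>\<close> has the same future code as
\<open>q\<close>, then the orbits of \<open>q\<close> and \<open>h x\<close> under \<open>g\<close> share their code, hence are asymptotic, and \<open>q\<close> lies on the stable manifold of the continuation.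
Because local stable manifolds are taken in an arbitrarily small neighbourhood of \<open>\<Lambda>\<close>, the disks are chosen close to an unstable leaf: the reference
disk is a piece of the \<open>N\<close>-th image of a segment along which \<open>y\<close> remains positive (\<open>reference_curve\<close>), and \<open>x\<close> is
taken with all past symbols positive. Then \<open>q\<close> and \<open>h x\<close> are close to a common unstable leaf and on a common stable leaf, hence close to each other
(\<open>same_past_close\<close>, \<open>blender_intersection\<close>), and the whole forward orbit of \<open>q\<close> remains near \<open>\<Lambda>\<close>.\<close>

section \<open>Linear recursions with an invariant cone\<close>

text \<open>The main estimate. The sequence \<open>(x, y, z)\<close> is an orbit, up to a relative error of \<open>10^{-6}\<close>, of matrices that
send \<open>(x, y, z)\<close> to \<open>(y, a y + 0.3 x, \<xi> z + y)\<close> with \<open>|a| \<ge> 4\<close>. This covers both tangent vectors and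
differences of two orbits. The cone \<open>|x| \<le> 2 max(|y|, |z| / 200)\<close> is invariant, and the maximum grows in it by a
factor of at least 1.004; hence an orbit with bounded \<open>y\<close> and \<open>z\<close> never enters the cone unless it vanishes, and
outside of the cone the vector is controlled by \<open>x\<close>, which contracts. The weight 200 makes the
coupling of \<open>z\<close> to \<open>y\<close> smaller than the weak expansion \<open>\<xi> \<ge> 1.01\<close>.\<close>
lemma cone_forward:
  fixes x y z a :: "nat \<Rightarrow> real"
  assumes xi: "(101 / 100) \<le> \<xi>"
    and a: "\<And>n. 4 \<le> \<bar>a n\<bar>"
    and X: "\<And>n. \<bar>x (Suc n) - y n\<bar> \<le> (\<bar>x n\<bar> + \<bar>y n\<bar> + \<bar>z n\<bar>) / 1000000"
    and Y: "\<And>n. \<bar>y (Suc n) - (a n * y n + 3 / 10 * x n)\<bar> \<le> (\<bar>x n\<bar> + \<bar>y n\<bar> + \<bar>z n\<bar>) / 1000000"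
    and Z: "\<And>n. \<bar>z (Suc n) - (\<xi> * z n + y n)\<bar> \<le> (\<bar>x n\<bar> + \<bar>y n\<bar> + \<bar>z n\<bar>) / 1000000"
    and bdd: "\<And>n. \<bar>y n\<bar> \<le> C" "\<And>n. \<bar>z n\<bar> \<le> C"
  shows "\<bar>y n\<bar> \<le> \<bar>x n\<bar> / 2" "\<bar>z n\<bar> \<le> 100 * \<bar>x n\<bar>" "\<bar>x (Suc n)\<bar> \<le> (51 / 100) * \<bar>x n\<bar>"
proof -
  define m where "m n = max \<bar>y n\<bar> (\<bar>z n\<bar> / 200)" for n
  have step: "\<bar>x (Suc n)\<bar> \<le> 2 * m (Suc n) \<and> (251 / 250) * m n \<le> m (Suc n)" if h: "\<bar>x n\<bar> \<le> 2 * m n" for n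
  proof -
    have ym: "\<bar>y n\<bar> \<le> m n" and zm: "\<bar>z n\<bar> \<le> 200 * m n" unfolding m_def by auto
    have e: "(\<bar>x n\<bar> + \<bar>y n\<bar> + \<bar>z n\<bar>) / 1000000 \<le> (1 / 1000) * m n" using h ym zm by simp
    have xs: "\<bar>x (Suc n)\<bar> \<le> (1001 / 1000) * m n" using X[of n] e ym by linarith
    have "(251 / 250) * m n \<le> m (Suc n)"
    proof (cases "\<bar>z n\<bar> / 200 \<le> \<bar>y n\<bar>")
      case True
      then have my: "m n = \<bar>y n\<bar>" unfolding m_def by simp
      have "4 * \<bar>y n\<bar> \<le> \<bar>a n * y n\<bar>" using mult_right_mono[OF a[of n], of "\<bar>y n\<bar>"] by (simp add: abs_mult)
      then have "2 * m n \<le> \<bar>y (Suc n)\<bar>" using Y[of n] e h my by linarith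
      then show ?thesis unfolding m_def[of "Suc n"] using ym by linarith
    next
      case False
      then have mz: "\<bar>z n\<bar> = 200 * m n" unfolding m_def by simp
      have "(101 / 100) * \<bar>z n\<bar> \<le> \<bar>\<xi> * z n\<bar>" using mult_right_mono[OF xi, of "\<bar>z n\<bar>"] xi by (simp add: abs_mult)
      then have "200 * ((251 / 250) * m n) \<le> \<bar>z (Suc n)\<bar>" using Z[of n] e ym mz by linarith
      then show ?thesis unfolding m_def[of "Suc n"] by linarith
    qed
    then show ?thesis using xs ym by linarith
  qed
  have zero: "x n = 0 \<and> y n = 0 \<and> z n = 0" if h: "\<bar>x n\<bar> \<le> 2 * m n" for n
  proof -
    have grow: "\<bar>x (n + k)\<bar> \<le> 2 * m (n + k) \<and> (251 / 250) ^ k * m n \<le> m (n + k)" for k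
    proof (induction k)
      case (Suc k)
      have "(251 / 250) ^ Suc k * m n \<le> (251 / 250) * m (n + k)" using Suc
        by (simp only: power_Suc mult.assoc) (intro mult_left_mono, auto)
      with step[of "n + k"] Suc show ?case by auto
    qed (use h in auto)
    have "m n = 0"
    proof (rule ccontr)
      assume "m n \<noteq> 0"
      then have pos: "0 < m n" unfolding m_def by (auto simp: max_def split: if_splits)
      obtain k where k: "C / m n < (251 / 250) ^ k" using real_arch_pow[of "(251 / 250)" "C / m n"] by auto
      have "m (n + k) \<le> C" using bdd[of "n + k"] unfolding m_def by auto
      with grow[of k] have "(251 / 250) ^ k * m n \<le> C" by linarith
      with k pos show False by (simp add: field_simps)
    qed
    with h show ?thesis unfolding m_def by (auto simp: max_def split: if_splits)
  qed
  have "\<bar>y n\<bar> \<le> \<bar>x n\<bar> / 2 \<and> \<bar>z n\<bar> \<le> 100 * \<bar>x n\<bar>"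
  proof (cases "\<bar>x n\<bar> \<le> 2 * m n")
    case True with zero show ?thesis by auto
  next
    case False then show ?thesis unfolding m_def by auto
  qed
  then show 1: "\<bar>y n\<bar> \<le> \<bar>x n\<bar> / 2" and 2: "\<bar>z n\<bar> \<le> 100 * \<bar>x n\<bar>" by auto
  then have "(\<bar>x n\<bar> + \<bar>y n\<bar> + \<bar>z n\<bar>) / 1000000 \<le> (1 / 100) * \<bar>x n\<bar>" by simp
  with X[of n] 1 show "\<bar>x (Suc n)\<bar> \<le> (51 / 100) * \<bar>x n\<bar>" by linarith
qed

text \<open>The index runs backwards in time: \<open>(x n, y n)\<close> is the image of \<open>(x (n + 1), y (n + 1))\<close>. Outside of the
unstable cone \<open>2 |x| < |y|\<close> the inverse matrices expand the first component by a factor of at least 6.\<close>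
lemma backward_growth:
  fixes x y a :: "nat \<Rightarrow> real"
  assumes a: "\<And>n. n < N \<Longrightarrow> 4 \<le> \<bar>a n\<bar>"
    and X: "\<And>n. n < N \<Longrightarrow> x n = y (Suc n)"
    and Y: "\<And>n. n < N \<Longrightarrow> y n = a n * y (Suc n) + 3 / 10 * x (Suc n)"
    and 0: "\<bar>y 0\<bar> \<le> 2 * \<bar>x 0\<bar>"
  shows "n \<le> N \<Longrightarrow> 6 ^ n * \<bar>x 0\<bar> \<le> \<bar>x n\<bar> \<and> \<bar>y n\<bar> \<le> 2 * \<bar>x n\<bar>"
proof (induction n)
  case (Suc n)
  then have n: "n < N" and IH: "6 ^ n * \<bar>x 0\<bar> \<le> \<bar>x n\<bar>" "\<bar>y n\<bar> \<le> 2 * \<bar>x n\<bar>" by auto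
  have "4 * \<bar>y (Suc n)\<bar> \<le> \<bar>a n * y (Suc n)\<bar>" using mult_right_mono[OF a[OF n], of "\<bar>y (Suc n)\<bar>"] by (simp add: abs_mult)
  then have "6 * \<bar>x n\<bar> \<le> \<bar>x (Suc n)\<bar>" using Y[OF n] X[OF n] IH(2) by linarith
  then show ?case using IH X[OF n] by auto
qed (use 0 in auto)

text \<open>The index again runs backwards in time. A sequence that is bounded in the past lies in the unstable cone,
where the weighted norm \<open>|z| + 2 |y|\<close> contracts under the inverse by the factor \<open>1 / \<xi>\<close>.\<close>
lemma cone_backward:
  fixes x y z a :: "nat \<Rightarrow> real"
  assumes xi: "1 \<le> \<xi>" "\<xi> \<le> 3 / 2"
    and a: "\<And>n. 4 \<le> \<bar>a n\<bar>"
    and X: "\<And>n. x n = y (Suc n)"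
    and Y: "\<And>n. y n = a n * y (Suc n) + 3 / 10 * x (Suc n)"
    and Z: "\<And>n. z n = \<xi> * z (Suc n) + y (Suc n)"
    and bdd: "\<And>n. \<bar>x n\<bar> \<le> C"
  shows "\<bar>x n\<bar> \<le> \<bar>y n\<bar> / 2"
    and "\<bar>z n\<bar> + 2 * \<bar>y n\<bar> \<le> (1 / \<xi>) ^ n * (\<bar>z 0\<bar> + 2 * \<bar>y 0\<bar>)"
proof -
  have 1: "\<bar>x n\<bar> \<le> \<bar>y n\<bar> / 2" for n
  proof (rule ccontr)
    assume h: "\<not> \<bar>x n\<bar> \<le> \<bar>y n\<bar> / 2"
    obtain k where k: "C / \<bar>x n\<bar> < 6 ^ k" using real_arch_pow[of 6 "C / \<bar>x n\<bar>"] by auto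
    have "6 ^ k * \<bar>x (n + 0)\<bar> \<le> \<bar>x (n + k)\<bar> \<and> \<bar>y (n + k)\<bar> \<le> 2 * \<bar>x (n + k)\<bar>"
    proof (rule backward_growth[where x="\<lambda>k. x (n + k)" and y="\<lambda>k. y (n + k)" and a="\<lambda>k. a (n + k)" and N = k])
      show "y (n + i) = a (n + i) * y (n + Suc i) + 3 / 10 * x (n + Suc i)" for i
        using Y[of "n + i"] by (simp only: add_Suc_right)
    qed (use a X h in auto)
    with bdd[of "n + k"] have "6 ^ k * \<bar>x n\<bar> \<le> C" by auto
    with k h show False by (simp add: field_simps split: if_splits)
  qed
  show "\<bar>x n\<bar> \<le> \<bar>y n\<bar> / 2" by (rule 1)
  show "\<bar>z n\<bar> + 2 * \<bar>y n\<bar> \<le> (1 / \<xi>) ^ n * (\<bar>z 0\<bar> + 2 * \<bar>y 0\<bar>)"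
  proof (induction n)
    case (Suc n)
    have y: "\<bar>y (Suc n)\<bar> \<le> \<bar>y n\<bar> / 2" using 1[of n] X[of n] by simp
    have "\<xi> * \<bar>z (Suc n)\<bar> = \<bar>\<xi> * z (Suc n)\<bar>" using xi by (simp add: abs_mult)
    then have "\<xi> * \<bar>z (Suc n)\<bar> \<le> \<bar>z n\<bar> + \<bar>y (Suc n)\<bar>" using Z[of n] by linarith
    moreover have "\<xi> * (2 * \<bar>y (Suc n)\<bar>) \<le> 3 / 2 * (2 * \<bar>y (Suc n)\<bar>)" using xi by (intro mult_right_mono) auto
    ultimately have "\<xi> * (\<bar>z (Suc n)\<bar> + 2 * \<bar>y (Suc n)\<bar>) \<le> \<bar>z n\<bar> + 2 * \<bar>y n\<bar>"
      using y by (simp only: distrib_left)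
    then have "\<bar>z (Suc n)\<bar> + 2 * \<bar>y (Suc n)\<bar> \<le> (1 / \<xi>) * (\<bar>z n\<bar> + 2 * \<bar>y n\<bar>)"
      using xi by (simp add: field_simps)
    also have "\<dots> \<le> (1 / \<xi>) * ((1 / \<xi>) ^ n * (\<bar>z 0\<bar> + 2 * \<bar>y 0\<bar>))"
      using Suc xi by (intro mult_left_mono) auto
    finally show ?case by (simp add: mult.assoc)
  qed simp
qed

text \<open>A contraction principle on the space of bounded bi-infinite sequences. It produces orbits with prescribed itinerary,
bounded solutions of the equation for \<open>z\<close>, and bounded solutions of inhomogeneous linearised equations.\<close>
lemma bounded_solution:
  fixes \<phi> :: "int \<Rightarrow> real \<Rightarrow> real \<Rightarrow> real"
  assumes k: "0 \<le> \<kappa>" "\<kappa> < 1"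
    and lip: "\<And>j a b a' b'. \<bar>\<phi> j a b - \<phi> j a' b'\<bar> \<le> \<kappa> * max \<bar>a - a'\<bar> \<bar>b - b'\<bar>"
    and bdd: "\<And>j. \<bar>\<phi> j 0 0\<bar> \<le> C"
  shows "\<exists>u B. (\<forall>j. \<bar>u j\<bar> \<le> B) \<and> (\<forall>j. u j = \<phi> j (u (j + 1)) (u (j - 1)))"
proof -
  \<comment> \<open>Picard iteration from the zero sequence\<close>
  define v where "v = rec_nat (\<lambda>_. 0) (\<lambda>_ u j. \<phi> j (u (j + 1)) (u (j - 1)))"
  have v0: "v 0 j = 0" and vS: "v (Suc n) j = \<phi> j (v n (j + 1)) (v n (j - 1))" for n j
    by (simp_all add: v_def)
  have diff: "\<bar>v (Suc n) j - v n j\<bar> \<le> C * \<kappa> ^ n" for n j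
  proof (induction n arbitrary: j)
    case 0 then show ?case using bdd[of j] by (simp add: v0 vS)
  next
    case (Suc n)
    have "\<bar>v (Suc (Suc n)) j - v (Suc n) j\<bar> \<le> \<kappa> * (C * \<kappa> ^ n)"
      unfolding vS[of "Suc n"] vS[of n j]
      by (rule order.trans[OF lip]) (use Suc k in \<open>auto intro!: mult_left_mono\<close>)
    then show ?case by (simp add: mult_ac)
  qed
  have summ: "summable (\<lambda>n. C * \<kappa> ^ n)" using k by (intro summable_mult summable_geometric) auto
  define u where "u j = (\<Sum>n. v (Suc n) j - v n j)" for j
  have sj: "summable (\<lambda>n. \<bar>v (Suc n) j - v n j\<bar>)" for j
    by (rule summable_comparison_test'[OF summ, of 0]) (use diff in auto)
  have lim: "(\<lambda>n. v n j) \<longlonglongrightarrow> u j" for j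
    using summable_LIMSEQ[OF summable_rabs_cancel[OF sj[of j]]] unfolding u_def
      sum_lessThan_telescope[of "\<lambda>n. v n j"] by (simp add: v0)
  show ?thesis
  proof (intro exI conjI allI)
    fix j
    show "\<bar>u j\<bar> \<le> (\<Sum>n. C * \<kappa> ^ n)"
      unfolding u_def using summable_rabs[OF sj[of j]] suminf_le[OF diff sj[of j] summ] by linarith
    have "(\<lambda>n. max \<bar>v n (j + 1) - u (j + 1)\<bar> \<bar>v n (j - 1) - u (j - 1)\<bar>) \<longlonglongrightarrow> max 0 0"
      using lim[of "j + 1"] lim[of "j - 1"] by (intro tendsto_max) (simp_all add: LIM_zero tendsto_rabs_zero)
    then have "(\<lambda>n. \<kappa> * max \<bar>v n (j + 1) - u (j + 1)\<bar> \<bar>v n (j - 1) - u (j - 1)\<bar>) \<longlonglongrightarrow> 0"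
      using tendsto_mult_right_zero by fastforce
    then have "(\<lambda>n. v (Suc n) j - \<phi> j (u (j + 1)) (u (j - 1))) \<longlonglongrightarrow> 0"
      by (rule Lim_null_comparison[rotated]) (use lip in \<open>simp add: vS\<close>)
    then have "(\<lambda>n. v (Suc n) j) \<longlonglongrightarrow> \<phi> j (u (j + 1)) (u (j - 1))" by (rule LIM_zero_cancel)
    then show "u j = \<phi> j (u (j + 1)) (u (j - 1))"
      using LIMSEQ_unique LIMSEQ_Suc[OF lim[of j]] by blast
  qed
qed

lemma divide_lipschitz:
  fixes \<xi> :: real
  assumes "0 < \<xi>"
  shows "\<bar>(r - t) / \<xi> - (r' - t) / \<xi>\<bar> \<le> 1 / \<xi> * max \<bar>r - r'\<bar> m"
proof -
  have "(r - t) / \<xi> - (r' - t) / \<xi> = 1 / \<xi> * (r - r')" by (simp add: diff_divide_distrib)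
  then have "\<bar>(r - t) / \<xi> - (r' - t) / \<xi>\<bar> = 1 / \<xi> * \<bar>r - r'\<bar>" using assms by (simp only: abs_mult) simp
  then show ?thesis using assms by (simp only:) (intro mult_left_mono, auto)
qed

lemma divide_bound:
  fixes \<xi> :: real
  assumes "1 \<le> \<xi>" "\<bar>t\<bar> \<le> C"
  shows "\<bar>(0 - t) / \<xi>\<bar> \<le> C"
proof -
  have "C * 1 \<le> C * \<xi>" using assms by (intro mult_left_mono) auto
  then have "\<bar>t\<bar> / \<xi> \<le> C" using assms by (simp only: pos_divide_le_eq)
  then show ?thesis using assms(1) by (simp add: abs_divide)
qed

text \<open>There is a sequence that contains every finite word: the positions \<open>m\<^sup>2, \<dots>, m\<^sup>2 + 2 m\<close> carry the binary expansion
of the first component of the pair coded by \<open>m\<close>, and each number is such a component for arbitrarily large \<open>m\<close>.\<close>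
lemma universal_sequence:
  obtains s :: "int \<Rightarrow> bool" where "\<And>w n. \<exists>k::nat. \<forall>i. \<bar>i\<bar> \<le> int n \<longrightarrow> s (int k + i) = w i"
proof
  define s where "s j \<longleftrightarrow>
     nat j - (floor_sqrt (nat j))\<^sup>2 \<in> set_decode (fst (prod_decode (floor_sqrt (nat j))))" for j :: int
  fix w :: "int \<Rightarrow> bool" and n :: nat
  define v where "v = set_encode {i. i \<le> 2 * n \<and> w (int i - int n)}"
  have v: "set_decode v = {i. i \<le> 2 * n \<and> w (int i - int n)}" unfolding v_def
    by (rule set_encode_inverse) (rule finite_subset[of _ "{..2*n}"], auto)
  define m where "m = prod_encode (v, n)"
  have mn: "n \<le> m" unfolding m_def by (rule le_prod_encode_2)
  have "s (int (m\<^sup>2 + n) + i) = w i" if "\<bar>i\<bar> \<le> int n" for i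
  proof -
    define l where "l = nat (i + int n)"
    have l: "i = int l - int n" "l \<le> 2 * n" using that unfolding l_def by auto
    have j: "nat (int (m\<^sup>2 + n) + i) = m\<^sup>2 + l" using l
      by (simp_all add: nat_add_distrib flip: of_nat_power of_nat_add)
    have "floor_sqrt (m\<^sup>2 + l) = m"
      by (rule floor_sqrt_unique) (use l mn in \<open>auto simp: power2_eq_square\<close>)
    then show ?thesis unfolding s_def j using l v by (simp add: m_def)
  qed
  then show "\<exists>k::nat. \<forall>i. \<bar>i\<bar> \<le> int n \<longrightarrow> s (int k + i) = w i" by blast
qed

section \<open>Maps that are close in the C1 topology\<close>

lemma C1_on_has_derivative:
  assumes "C1_on S f" "x \<in> S"
  shows "(f has_derivative frechet_derivative f (at x within S)) (at x within S)"
  using assms unfolding C1_on_def by (metis differentiable_def frechet_derivative_works)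

lemma C1_close_trans:
  assumes fg: "C1_close S K e f g" and gh: "C1_close S K e' g h" and KS: "K \<subseteq> S"
    and C1: "C1_on S f" "C1_on S g" "C1_on S h"
  shows "C1_close S K (e + e') f h"
  unfolding C1_close_def
proof
  fix x assume x: "x \<in> K"
  define D where "D k = frechet_derivative k (at x within S)" for k :: "'a \<Rightarrow> 'b"
  have bl: "bounded_linear (D k)" if "C1_on S k" for k
    using C1_on_has_derivative[OF that, of x] x KS has_derivative_bounded_linear unfolding D_def by blast
  have "norm (f x - h x) \<le> norm (f x - g x) + norm (g x - h x)"
    using norm_triangle_ineq[of "f x - g x" "g x - h x"] by simp
  moreover have "onorm (\<lambda>v. D f v - D h v) \<le> onorm (\<lambda>v. D f v - D g v) + onorm (\<lambda>v. D g v - D h v)"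
    using onorm_triangle[OF bounded_linear_sub[OF bl[OF C1(1)] bl[OF C1(2)]]
        bounded_linear_sub[OF bl[OF C1(2)] bl[OF C1(3)]]] by simp
  ultimately show "norm (f x - h x) < e + e' \<and>
      onorm (\<lambda>v. frechet_derivative f (at x within S) v - frechet_derivative h (at x within S) v) < e + e'"
    using fg gh x unfolding C1_close_def D_def by fastforce
qed

lemma C1_open_ball:
  assumes "compact K" "K \<subseteq> S" and X: "\<And>g. g \<in> X \<Longrightarrow> C1_on S g" and f: "f \<in> X"
  shows "C1_open S X {g \<in> X. \<exists>e<\<epsilon>. C1_close S K e f g}"
  unfolding C1_open_def
proof (intro conjI ballI)
  fix g assume "g \<in> {g \<in> X. \<exists>e<\<epsilon>. C1_close S K e f g}"
  then obtain e where e: "g \<in> X" "e < \<epsilon>" "C1_close S K e f g" by auto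
  have "h \<in> {g \<in> X. \<exists>e<\<epsilon>. C1_close S K e f g}" if h: "h \<in> X" "C1_close S K ((\<epsilon> - e) / 2) g h" for h
    using C1_close_trans[OF e(3) h(2) assms(2) X[OF f] X[OF e(1)] X[OF h(1)]] e(2) h(1)
    by (auto intro!: exI[of _ "e + (\<epsilon> - e) / 2"] simp: field_simps)
  with assms e(2) show "\<exists>L e. compact L \<and> L \<subseteq> S \<and> e > 0 \<and>
      (\<forall>h\<in>X. C1_close S L e g h \<longrightarrow> h \<in> {g \<in> X. \<exists>e<\<epsilon>. C1_close S K e f g})"
    by (intro exI[of _ K] exI[of _ "(\<epsilon> - e) / 2"]) auto
qed auto

lemma C1_close_refl:
  assumes "0 < e" shows "C1_close S K e f f"
  unfolding C1_close_def using assms by (simp add: onorm_zero)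

lemma C1_close_lipschitz:
  assumes close: "C1_close S K e f g" and K: "convex K" "K \<subseteq> S"
    and C1: "C1_on S f" "C1_on S g" and xy: "x \<in> K" "y \<in> K"
  shows "norm ((f x - g x) - (f y - g y)) \<le> e * norm (x - y)"
proof (rule differentiable_bound[OF K(1) _ _ xy])
  fix z assume z: "z \<in> K"
  then show "((\<lambda>x. f x - g x) has_derivative
      (\<lambda>v. frechet_derivative f (at z within S) v - frechet_derivative g (at z within S) v)) (at z within K)"
    using K by (intro has_derivative_subset[OF has_derivative_diff[OF C1_on_has_derivative C1_on_has_derivative]] C1) auto
  show "onorm (\<lambda>v. frechet_derivative f (at z within S) v - frechet_derivative g (at z within S) v) \<le> e"
    using close z unfolding C1_close_def by force
qed

lemma C1_on_compose:
  assumes "C1_on UNIV f" "C1_on S g"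
  shows "C1_on S (\<lambda>x. f (g x))"
proof -
  obtain f' g' where f: "\<And>x. (f has_derivative blinfun_apply (f' x)) (at x)" "continuous_on UNIV f'"
    and g: "\<And>x. x \<in> S \<Longrightarrow> (g has_derivative blinfun_apply (g' x)) (at x within S)" "continuous_on S g'"
    using assms unfolding C1_on_def by auto
  have gc: "continuous_on S g"
    using g(1) by (meson has_derivative_continuous continuous_on_eq_continuous_within)
  show ?thesis unfolding C1_on_def
  proof (intro exI[of _ "\<lambda>x. f' (g x) o\<^sub>L g' x"] conjI ballI)
    fix x assume "x \<in> S"
    have "((\<lambda>x. f (g x)) has_derivative (\<lambda>v. blinfun_apply (f' (g x)) (blinfun_apply (g' x) v))) (at x within S)"
      by (rule has_derivative_compose[OF g(1)[OF \<open>x \<in> S\<close>] f(1)])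
    then show "((\<lambda>x. f (g x)) has_derivative blinfun_apply (f' (g x) o\<^sub>L g' x)) (at x within S)"
      by (simp add: blinfun_compose.rep_eq o_def)
  next
    show "continuous_on S (\<lambda>x. f' (g x) o\<^sub>L g' x)"
      by (intro bounded_bilinear.continuous_on[OF bounded_bilinear_blinfun_compose]
          continuous_on_compose2[OF f(2) gc] g(2)) auto
  qed
qed

lemma C1_on_funpow:
  fixes f :: "'a::euclidean_space \<Rightarrow> 'a"
  assumes "C1_on UNIV f" shows "C1_on UNIV (f ^^ n)"
proof (induction n)
  case 0
  show ?case unfolding C1_on_def
    by (intro exI[of _ "\<lambda>_::'a. id_blinfun :: 'a \<Rightarrow>\<^sub>L 'a"]) (auto simp: id_def)
next
  case (Suc n)
  then show ?case using C1_on_compose[OF assms Suc] by (simp add: o_def)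
qed

text \<open>A curve that expands distances by a factor bounded below is an immersion.\<close>
lemma inj_derivative_within:
  fixes f :: "real \<Rightarrow> 'a::euclidean_space"
  assumes f': "(f has_derivative f') (at x within {a..b})" and x: "x \<in> {a..b}" and "a < b" and c: "0 < c"
    and expand: "\<And>s t. s \<in> {a..b} \<Longrightarrow> t \<in> {a..b} \<Longrightarrow> c * \<bar>s - t\<bar> \<le> norm (f s - f t)"
  shows "inj f'"
proof -
  have lin: "linear f'" using f' has_derivative_linear by blast
  have nz: "f' 1 \<noteq> 0"
  proof
    assume 0: "f' 1 = 0"
    have z: "f' v = 0" for v using linear_scale[OF lin, of v 1] 0 by simp
    obtain d where d: "0 < d" "\<And>y. y \<in> {a..b} \<Longrightarrow> norm (y - x) < d \<Longrightarrow> norm (f y - f x - f' (y - x)) \<le> c / 2 * norm (y - x)"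
      using f' c unfolding has_derivative_within_alt by (metis half_gt_zero)
    obtain y where y: "y \<in> {a..b}" "y \<noteq> x" "\<bar>y - x\<bar> < d"
    proof (cases "x < b")
      case True
      then show ?thesis using x d(1) by (intro that[of "x + min (d / 2) (b - x)"]) (auto simp: min_def)
    next
      case False
      then show ?thesis using x d(1) \<open>a < b\<close> by (intro that[of "x - min (d / 2) (b - a)"]) (auto simp: min_def)
    qed
    from d(2)[of y] y expand[OF y(1) x] have "c * \<bar>y - x\<bar> \<le> c / 2 * \<bar>y - x\<bar>" by (simp add: z)
    with c y show False by simp
  qed
  have "v = 0" if "f' v = 0" for v using linear_scale[OF lin, of v 1] that nz by simp
  then show ?thesis using linear_injective_0[OF lin] by blast
qed

section \<open>The Henon-like map and its derivative\<close>

lemma vector3_eqI: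
  fixes u v :: "real ^ 3"
  assumes "u $ 1 = v $ 1" "u $ 2 = v $ 2" "u $ 3 = v $ 3"
  shows "u = v"
  using assms by (simp add: vec_eq_iff forall_3)

lemma norm_le_sum3: "norm (v :: real ^ 3) \<le> \<bar>v $ 1\<bar> + \<bar>v $ 2\<bar> + \<bar>v $ 3\<bar>"
  using norm_le_l1_cart[of v] by (simp add: sum_3)

lemma has_derivative_vector3:
  fixes f :: "'a::real_normed_vector \<Rightarrow> real ^ 3"
  assumes "((\<lambda>x. f x $ 1) has_derivative (\<lambda>v. f' v $ 1)) F" "((\<lambda>x. f x $ 2) has_derivative (\<lambda>v. f' v $ 2)) F"
    "((\<lambda>x. f x $ 3) has_derivative (\<lambda>v. f' v $ 3)) F"
  shows "(f has_derivative f') F"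
proof -
  have eq: "w = w $ 1 *\<^sub>R axis 1 1 + w $ 2 *\<^sub>R axis 2 1 + w $ 3 *\<^sub>R axis 3 1" for w :: "real ^ 3"
    by (rule vector3_eqI) (simp_all add: axis_def)
  have "((\<lambda>x. f x $ 1 *\<^sub>R axis (1::3) (1::real) + f x $ 2 *\<^sub>R axis 2 1 + f x $ 3 *\<^sub>R axis 3 1) has_derivative
      (\<lambda>v. f' v $ 1 *\<^sub>R axis (1::3) (1::real) + f' v $ 2 *\<^sub>R axis 2 1 + f' v $ 3 *\<^sub>R axis 3 1)) F"
    by (intro has_derivative_add has_derivative_scaleR_left assms)
  then show ?thesis by (simp flip: eq)
qed

lemma has_derivative_vec_nth: "((\<lambda>x. x $ i) has_derivative (\<lambda>v. v $ i)) F"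
  for F :: "(real ^ 'n) filter"
  by (rule bounded_linear.has_derivative[OF bounded_linear_vec_nth has_derivative_ident])

text \<open>The parameter \<open>\<xi>\<close> is the weak expansion rate. The lower bound gives a uniform rate of hyperbolicity; the upper bound
is what the covering property of admissible sets needs.\<close>
locale henon =
  fixes \<xi> :: real
  assumes xi: "101 / 100 \<le> \<xi>" "\<xi> \<le> 9 / 8"
begin

lemma xi_pos: "0 < \<xi>" "1 < \<xi>" "\<xi> \<noteq> 0" using xi by auto

definition f :: "real ^ 3 \<Rightarrow> real ^ 3" where "f = henon_like (-9.5) 0.3 \<xi>"

lemma f_nth [simp]: "f v $ 1 = v $ 2" "f v $ 2 = (v $ 2)\<^sup>2 + 3 / 10 * v $ 1 - 19 / 2" "f v $ 3 = \<xi> * v $ 3 + v $ 2"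
  by (simp_all add: f_def henon_like_def vector_3)

text \<open>The inverse of the map.\<close>
definition finv :: "real ^ 3 \<Rightarrow> real ^ 3" where
  "finv v = vector [10 / 3 * (v $ 2 + 19 / 2 - (v $ 1)\<^sup>2), v $ 1, (v $ 3 - v $ 1) / \<xi>]"

lemma finv_nth [simp]: "finv v $ 1 = 10 / 3 * (v $ 2 + 19 / 2 - (v $ 1)\<^sup>2)" "finv v $ 2 = v $ 1"
    "finv v $ 3 = (v $ 3 - v $ 1) / \<xi>"
  by (simp_all add: finv_def vector_3)

lemma f_finv [simp]: "f (finv v) = v" and finv_f [simp]: "finv (f v) = v"
  by (rule vector3_eqI; simp add: field_simps xi_pos)+

lemma bij_f: "bij f" by (rule o_bij[of finv]) auto

lemma inv_f: "inv f = finv" by (rule inv_equality) auto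

text \<open>The derivative of the map at \<open>p\<close>.\<close>
definition Df :: "real ^ 3 \<Rightarrow> real ^ 3 \<Rightarrow> real ^ 3" where
  "Df p v = vector [v $ 2, 2 * p $ 2 * v $ 2 + 3 / 10 * v $ 1, \<xi> * v $ 3 + v $ 2]"

text \<open>The derivative of the inverse at \<open>p\<close>.\<close>
definition Dg :: "real ^ 3 \<Rightarrow> real ^ 3 \<Rightarrow> real ^ 3" where
  "Dg p v = vector [10 / 3 * (v $ 2 - 2 * p $ 1 * v $ 1), v $ 1, (v $ 3 - v $ 1) / \<xi>]"

lemma Df_nth [simp]: "Df p v $ 1 = v $ 2" "Df p v $ 2 = 2 * p $ 2 * v $ 2 + 3 / 10 * v $ 1"
    "Df p v $ 3 = \<xi> * v $ 3 + v $ 2"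
  by (simp_all add: Df_def vector_3)

lemma Dg_nth [simp]: "Dg p v $ 1 = 10 / 3 * (v $ 2 - 2 * p $ 1 * v $ 1)" "Dg p v $ 2 = v $ 1"
    "Dg p v $ 3 = (v $ 3 - v $ 1) / \<xi>"
  by (simp_all add: Dg_def vector_3)

lemma Dg_Df [simp]: "Dg (f p) (Df p v) = v" and Df_Dg [simp]: "Df p (Dg (f p) v) = v"
  by (rule vector3_eqI; simp add: field_simps xi_pos)+

lemma f_has_derivative: "(f has_derivative Df p) (at p)"
  by (rule has_derivative_vector3; simp;
    (rule derivative_eq_intros has_derivative_vec_nth refl | simp add: field_simps)+)

lemma finv_has_derivative: "(finv has_derivative Dg p) (at p)"
  by (rule has_derivative_vector3; simp add: xi_pos;
    (rule derivative_eq_intros has_derivative_vec_nth refl | simp add: xi_pos field_simps)+)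

lemma linear_Df: "linear (Df p)" using f_has_derivative has_derivative_linear by blast

text \<open>If the derivative depends in an affine way on one coordinate of the point, it is continuous.\<close>
lemma C1_on_affine_derivative:
  fixes F :: "real ^ 3 \<Rightarrow> real ^ 3"
  assumes F: "\<And>p. (F has_derivative D p) (at p)"
    and D: "\<And>p v. D p v = D 0 v + p $ i *\<^sub>R (D (axis i 1) v - D 0 v)"
  shows "C1_on UNIV F"
proof -
  have bl: "bounded_linear (D p)" for p using F has_derivative_bounded_linear by blast
  define A where "A = Blinfun (D 0)"
  define B where "B = Blinfun (\<lambda>v. D (axis i 1) v - D 0 v)"
  have A: "blinfun_apply A = D 0" unfolding A_def by (rule bounded_linear_Blinfun_apply[OF bl])
  have B: "blinfun_apply B = (\<lambda>v. D (axis i 1) v - D 0 v)" unfolding B_def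
    by (rule bounded_linear_Blinfun_apply[OF bounded_linear_sub[OF bl bl]])
  have "blinfun_apply (A + p $ i *\<^sub>R B) = D p" for p
  proof
    fix v show "blinfun_apply (A + p $ i *\<^sub>R B) v = D p v"
      unfolding blinfun.add_left blinfun.scaleR_left A B by (rule D[symmetric])
  qed
  then show ?thesis unfolding C1_on_def using F
    by (intro exI[of _ "\<lambda>p. A + p $ i *\<^sub>R B"]) (auto intro!: continuous_intros)
qed

lemma C1_f: "C1_on UNIV f"
  by (rule C1_on_affine_derivative[OF f_has_derivative, of 2], rule vector3_eqI) (auto simp: axis_def algebra_simps)

lemma C1_finv: "C1_on UNIV finv"
  by (rule C1_on_affine_derivative[OF finv_has_derivative, of 1], rule vector3_eqI)
    (auto simp: axis_def algebra_simps)

lemma f_diffeo: "f \<in> diffeos"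
  unfolding diffeos_def using bij_f C1_f C1_finv by (simp add: inv_f)

lemma continuous_f: "continuous_on UNIV f"
  by (simp add: continuous_on_eq_continuous_at has_derivative_continuous[OF f_has_derivative])

lemma continuous_finv: "continuous_on UNIV finv"
  by (simp add: continuous_on_eq_continuous_at has_derivative_continuous[OF finv_has_derivative])

end

section \<open>Contraction along common itineraries\<close>

lemma closed_abs_le_nth: "closed {v :: real ^ 'n. \<bar>v $ i\<bar> \<le> c}" "closed {v :: real ^ 'n. c \<le> \<bar>v $ i\<bar>}"
  by (intro closed_Collect_le continuous_intros)+

text \<open>The box with half side lengths \<open>a\<close>, \<open>b\<close>, \<open>c\<close> centred at the origin.\<close>
definition box3 :: "real \<Rightarrow> real \<Rightarrow> real \<Rightarrow> (real ^ 3) set" where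
  "box3 a b c = {v. \<bar>v $ 1\<bar> \<le> a \<and> \<bar>v $ 2\<bar> \<le> b \<and> \<bar>v $ 3\<bar> \<le> c}"

lemma box3_cbox: "box3 a b c = cbox (vector [- a, - b, - c]) (vector [a, b, c])"
  by (auto simp: box3_def cbox_interval less_eq_vec_def forall_3 vector_3)

lemma compact_box3: "compact (box3 a b c)" and convex_box3: "convex (box3 a b c)"
  by (simp_all add: box3_cbox)

context henon
begin

text \<open>The two half spaces of the coding: \<open>y \<ge> 2\<close> for \<open>True\<close> and \<open>y \<le> - 2\<close> for \<open>False\<close>. For two points on the same side,
\<open>u\<^sub>2\<^sup>2 - v\<^sub>2\<^sup>2 = (u\<^sub>2 + v\<^sub>2) (u\<^sub>2 - v\<^sub>2)\<close> is an expansion of \<open>u\<^sub>2 - v\<^sub>2\<close> by a factor of at least 4.\<close>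
definition side :: "bool \<Rightarrow> real ^ 3 \<Rightarrow> bool" where
  "side b v \<longleftrightarrow> (if b then 2 \<le> v $ 2 else v $ 2 \<le> - 2)"

lemma side_sum: "side b u \<Longrightarrow> side b v \<Longrightarrow> 4 \<le> \<bar>u $ 2 + v $ 2\<bar>"
  unfolding side_def by (auto split: if_splits)

text \<open>The closeness to \<open>f\<close> that is used below: on a box that contains all points of interest, the difference of the two maps is at most
\<open>10^{-6}\<close> in size and has Lipschitz constant at most \<open>10^{-6}\<close>. No derivative of \<open>g\<close> occurs.\<close>
definition f_near :: "(real ^ 3 \<Rightarrow> real ^ 3) \<Rightarrow> bool" where
  "f_near g \<longleftrightarrow> (\<forall>u\<in>box3 5 5 500. norm (f u - g u) \<le> 1 / 1000000 \<and>
     (\<forall>v\<in>box3 5 5 500. norm ((f u - g u) - (f v - g v)) \<le> norm (u - v) / 1000000))"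

lemma f_near_f: "f_near f" unfolding f_near_def by simp

lemma f_near_nth:
  assumes "f_near g" "u \<in> box3 5 5 500"
  shows "\<bar>g u $ 1 - u $ 2\<bar> \<le> 1 / 1000000"
    and "\<bar>g u $ 2 - ((u $ 2)\<^sup>2 + 3 / 10 * u $ 1 - 19 / 2)\<bar> \<le> 1 / 1000000"
    and "\<bar>g u $ 3 - (\<xi> * u $ 3 + u $ 2)\<bar> \<le> 1 / 1000000"
proof -
  have "\<bar>(f u - g u) $ i\<bar> \<le> 1 / 1000000" for i
    using component_le_norm_cart[of "f u - g u" i] assms unfolding f_near_def by force
  from this[of 1] this[of 2] this[of 3]
  show "\<bar>g u $ 1 - u $ 2\<bar> \<le> 1 / 1000000"
    and "\<bar>g u $ 2 - ((u $ 2)\<^sup>2 + 3 / 10 * u $ 1 - 19 / 2)\<bar> \<le> 1 / 1000000"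
    and "\<bar>g u $ 3 - (\<xi> * u $ 3 + u $ 2)\<bar> \<le> 1 / 1000000" by (simp_all add: abs_minus_commute)
qed

lemma f_near_diff:
  assumes "f_near g" "u \<in> box3 5 5 500" "v \<in> box3 5 5 500"
  defines "D \<equiv> \<bar>u $ 1 - v $ 1\<bar> + \<bar>u $ 2 - v $ 2\<bar> + \<bar>u $ 3 - v $ 3\<bar>"
  shows "\<bar>g u $ 1 - g v $ 1 - (u $ 2 - v $ 2)\<bar> \<le> D / 1000000"
    and "\<bar>g u $ 2 - g v $ 2 - ((u $ 2 + v $ 2) * (u $ 2 - v $ 2) + 3 / 10 * (u $ 1 - v $ 1))\<bar> \<le> D / 1000000"
    and "\<bar>g u $ 3 - g v $ 3 - (\<xi> * (u $ 3 - v $ 3) + (u $ 2 - v $ 2))\<bar> \<le> D / 1000000"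
proof -
  have n: "norm (u - v) \<le> D" using norm_le_sum3[of "u - v"] unfolding D_def by simp
  have c: "\<bar>((f u - g u) - (f v - g v)) $ i\<bar> \<le> D / 1000000" for i
  proof -
    have "\<bar>((f u - g u) - (f v - g v)) $ i\<bar> \<le> norm (u - v) / 1000000"
      using component_le_norm_cart[of "(f u - g u) - (f v - g v)" i] assms(1-3) unfolding f_near_def by force
    with n show ?thesis by linarith
  qed
  have e1: "g u $ 1 - g v $ 1 - (u $ 2 - v $ 2) = - ((f u - g u) - (f v - g v)) $ 1"
    and e2: "g u $ 2 - g v $ 2 - ((u $ 2 + v $ 2) * (u $ 2 - v $ 2) + 3 / 10 * (u $ 1 - v $ 1))
      = - ((f u - g u) - (f v - g v)) $ 2"
    and e3: "g u $ 3 - g v $ 3 - (\<xi> * (u $ 3 - v $ 3) + (u $ 2 - v $ 2)) = - ((f u - g u) - (f v - g v)) $ 3"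
    by (simp_all add: field_simps power2_eq_square)
  show "\<bar>g u $ 1 - g v $ 1 - (u $ 2 - v $ 2)\<bar> \<le> D / 1000000"
    and "\<bar>g u $ 2 - g v $ 2 - ((u $ 2 + v $ 2) * (u $ 2 - v $ 2) + 3 / 10 * (u $ 1 - v $ 1))\<bar> \<le> D / 1000000"
    and "\<bar>g u $ 3 - g v $ 3 - (\<xi> * (u $ 3 - v $ 3) + (u $ 2 - v $ 2))\<bar> \<le> D / 1000000"
    unfolding e1 e2 e3 abs_minus_cancel by (rule c)+
qed

text \<open>Two forward orbits of a map near \<open>f\<close> that remain in the box and are always on a common side are asymptotic to each other. No stable manifolds have to be
constructed for this: the differences form a bounded approximate orbit of the linear recursion.\<close>
lemma same_itinerary_contracts:
  fixes P Q :: "nat \<Rightarrow> real ^ 3"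
  assumes g: "f_near g"
    and P: "\<And>n. P (Suc n) = g (P n)" "\<And>n. P n \<in> box3 5 5 500"
    and Q: "\<And>n. Q (Suc n) = g (Q n)" "\<And>n. Q n \<in> box3 5 5 500"
    and side: "\<And>n. side (b n) (P n)" "\<And>n. side (b n) (Q n)"
  shows "\<bar>P n $ 2 - Q n $ 2\<bar> \<le> \<bar>P n $ 1 - Q n $ 1\<bar> / 2"
    and "\<bar>P n $ 3 - Q n $ 3\<bar> \<le> 100 * \<bar>P n $ 1 - Q n $ 1\<bar>"
    and "norm (P n - Q n) \<le> 102 * (51 / 100) ^ n * \<bar>P 0 $ 1 - Q 0 $ 1\<bar>"
proof -
  define x y z a where "x n = P n $ 1 - Q n $ 1" and "y n = P n $ 2 - Q n $ 2"
    and "z n = P n $ 3 - Q n $ 3" and "a n = P n $ 2 + Q n $ 2" for n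
  note cone = cone_forward[of \<xi> a x y z 1000, OF xi(1)]
  have a: "4 \<le> \<bar>a n\<bar>" for n unfolding a_def using side_sum side by blast
  have X: "\<bar>x (Suc n) - y n\<bar> \<le> (\<bar>x n\<bar> + \<bar>y n\<bar> + \<bar>z n\<bar>) / 1000000"
    and Y: "\<bar>y (Suc n) - (a n * y n + 3 / 10 * x n)\<bar> \<le> (\<bar>x n\<bar> + \<bar>y n\<bar> + \<bar>z n\<bar>) / 1000000"
    and Z: "\<bar>z (Suc n) - (\<xi> * z n + y n)\<bar> \<le> (\<bar>x n\<bar> + \<bar>y n\<bar> + \<bar>z n\<bar>) / 1000000" for n
    unfolding x_def y_def z_def a_def P(1) Q(1) by (rule f_near_diff[OF g P(2) Q(2)])+
  have yC: "\<bar>y n\<bar> \<le> 1000" and zC: "\<bar>z n\<bar> \<le> 1000" for n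
    using P(2)[of n] Q(2)[of n] unfolding box3_def y_def z_def by auto
  have 1: "\<bar>y n\<bar> \<le> \<bar>x n\<bar> / 2" and 2: "\<bar>z n\<bar> \<le> 100 * \<bar>x n\<bar>" and 3: "\<bar>x (Suc n)\<bar> \<le> 51 / 100 * \<bar>x n\<bar>" for n
    using cone[OF a X Y Z yC zC] by auto
  show "\<bar>P n $ 2 - Q n $ 2\<bar> \<le> \<bar>P n $ 1 - Q n $ 1\<bar> / 2"
    and "\<bar>P n $ 3 - Q n $ 3\<bar> \<le> 100 * \<bar>P n $ 1 - Q n $ 1\<bar>"
    using 1[of n] 2[of n] unfolding x_def y_def z_def by auto
  have xn: "\<bar>x n\<bar> \<le> (51 / 100) ^ n * \<bar>x 0\<bar>"
  proof (induction n)
    case (Suc n) with 3[of n] show ?case by simp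
  qed simp
  have "norm (P n - Q n) \<le> \<bar>x n\<bar> + \<bar>y n\<bar> + \<bar>z n\<bar>"
    using norm_le_sum3[of "P n - Q n"] unfolding x_def y_def z_def by simp
  also have "\<dots> \<le> 102 * \<bar>x n\<bar>" using 1[of n] 2[of n] by simp
  also have "\<dots> \<le> 102 * ((51 / 100) ^ n * \<bar>x 0\<bar>)" using xn by simp
  finally show "norm (P n - Q n) \<le> 102 * (51 / 100) ^ n * \<bar>P 0 $ 1 - Q 0 $ 1\<bar>" unfolding x_def by simp
qed

end

section \<open>The horseshoe\<close>

context henon
begin

text \<open>The full orbit of a point, indexed by the integers.\<close>
definition orb :: "real ^ 3 \<Rightarrow> int \<Rightarrow> real ^ 3" where
  "orb p j = (if 0 \<le> j then (f ^^ nat j) p else (finv ^^ nat (- j)) p)"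

lemma orb_0 [simp]: "orb p 0 = p" by (simp add: orb_def)

lemma orb_add1: "orb p (j + 1) = f (orb p j)"
proof (cases "0 \<le> j")
  case True
  then show ?thesis by (simp add: orb_def nat_add_distrib)
next
  case False
  then obtain m where m: "j = - int (Suc m)" by (metis int_cases not_le of_nat_0_le_iff)
  have "orb p (j + 1) = (finv ^^ m) p" unfolding m by (cases m) (simp_all add: orb_def nat_add_distrib)
  moreover have "orb p j = finv ((finv ^^ m) p)" by (simp add: m orb_def nat_add_distrib)
  ultimately show ?thesis by simp
qed

lemma orb_unique:
  assumes "\<And>j. q (j + 1) = f (q j)"
  shows "q j = orb (q 0) j"
proof (induction j rule: int_induct[of _ 0])
  case (step1 i)
  then show ?case by (simp add: assms orb_add1)
next
  case (step2 i)
  have "f (q (i - 1)) = f (orb (q 0) (i - 1))"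
    using assms[of "i - 1"] orb_add1[of "q 0" "i - 1"] step2 by simp
  then show ?case by (metis finv_f)
qed simp

lemma orb_orb: "orb (orb p k) j = orb p (k + j)"
  using orb_unique[of "\<lambda>j. orb p (k + j)" j] by (simp add: orb_add1 flip: add.assoc)

lemma orb_nat: "orb p (int n) = (f ^^ n) p" by (simp add: orb_def)

lemma orb_minus_nat: "orb p (- int n) = (finv ^^ n) p" by (cases n) (simp_all add: orb_def nat_add_distrib)

lemma continuous_orb: "continuous_on UNIV (\<lambda>p. orb p j)"
proof (induction j rule: int_induct[of _ 0])
  case (step1 i)
  then show ?case unfolding orb_add1 by (intro continuous_on_compose2[OF continuous_f]) auto
next
  case (step2 i)
  have "orb p (i - 1) = finv (orb p i)" for p using orb_add1[of p "i - 1"] by simp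
  then show ?case using step2 by (auto intro!: continuous_on_compose2[OF continuous_finv])
qed simp

text \<open>The horseshoe is the maximal invariant set in this box; each of its points has \<open>y\<close>-coordinate of absolute value at least 2.05.
The bound on \<open>z\<close> is \<open>4 / (\<xi> - 1)\<close> for the smallest \<open>\<xi>\<close>.\<close>
definition Box :: "(real ^ 3) set" where
  "Box = {v. \<bar>v $ 1\<bar> \<le> 4 \<and> 41 / 20 \<le> \<bar>v $ 2\<bar> \<and> \<bar>v $ 2\<bar> \<le> 4 \<and> \<bar>v $ 3\<bar> \<le> 400}"

text \<open>The hyperbolic set of the blender; it is a full shift on two symbols, coded by the sign of \<open>y\<close>.\<close>
definition \<Lambda> :: "(real ^ 3) set" where "\<Lambda> = {p. \<forall>j. orb p j \<in> Box}"

lemma Box_box3: "Box = box3 4 4 400 \<inter> {v. 41 / 20 \<le> \<bar>v $ 2\<bar>}"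
  unfolding Box_def box3_def by auto

lemma compact_Box: "compact Box"
  unfolding Box_box3 by (intro compact_Int_closed compact_box3 closed_abs_le_nth)

lemma \<Lambda>_orb_Box: "p \<in> \<Lambda> \<Longrightarrow> orb p j \<in> Box" unfolding \<Lambda>_def by simp

lemma \<Lambda>_Box: "p \<in> \<Lambda> \<Longrightarrow> p \<in> Box" using \<Lambda>_orb_Box[of p 0] by simp

lemma Box_box: "p \<in> Box \<Longrightarrow> p \<in> box3 5 5 500" unfolding Box_def box3_def by auto

lemma Box_side: "p \<in> Box \<Longrightarrow> side (0 < p $ 2) p" unfolding Box_def side_def by auto

lemma compact_\<Lambda>: "compact \<Lambda>"
proof -
  have eq: "\<Lambda> = Box \<inter> (\<Inter>j. (\<lambda>p. orb p j) -` Box)" using \<Lambda>_Box by (auto simp: \<Lambda>_def)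
  have "closed ((\<lambda>p. orb p j) -` Box)" for j
    using continuous_orb compact_imp_closed[OF compact_Box] by (rule closed_vimage[rotated])
  then show ?thesis unfolding eq by (intro compact_Int_closed compact_Box closed_INT) auto
qed

lemma orb_in_\<Lambda>: "p \<in> \<Lambda> \<Longrightarrow> orb p j \<in> \<Lambda>" unfolding \<Lambda>_def by (simp add: orb_orb)

lemma f_in_\<Lambda>: "p \<in> \<Lambda> \<Longrightarrow> f p \<in> \<Lambda>" using orb_in_\<Lambda>[of p 1] orb_add1[of p 0] by simp

lemma f_image_\<Lambda>: "f ` \<Lambda> = \<Lambda>"
proof
  show "\<Lambda> \<subseteq> f ` \<Lambda>"
  proof
    fix p assume "p \<in> \<Lambda>"
    then have "orb p (-1) \<in> \<Lambda>" "f (orb p (-1)) = p" using orb_in_\<Lambda> orb_add1[of p "-1"] by auto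
    then show "p \<in> f ` \<Lambda>" by (metis imageI)
  qed
qed (use f_in_\<Lambda> in auto)

lemma itinerary_unique:
  assumes p: "p \<in> \<Lambda>" and q: "q \<in> \<Lambda>" and same: "\<And>j. 0 < orb p j $ 2 \<longleftrightarrow> 0 < orb q j $ 2"
  shows "p = q"
proof -
  have "norm (p - q) \<le> 816 * (51 / 100) ^ n" for n
  proof -
    \<comment> \<open>start \<open>n\<close> steps in the past, where the distance is bounded, and contract\<close>
    define P where "P r i = orb r (int i - int n)" for r i
    have 1: "P r (Suc i) = f (P r i)" for r i unfolding P_def using orb_add1[of r "int i - int n"]
      by (simp add: algebra_simps)
    have 2: "P r i \<in> Box" if "r \<in> \<Lambda>" for r i using \<Lambda>_orb_Box[OF that] by (simp add: P_def)
    have "norm (P p n - P q n) \<le> 102 * (51 / 100) ^ n * \<bar>P p 0 $ 1 - P q 0 $ 1\<bar>"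
    proof (rule same_itinerary_contracts(3)[OF f_near_f, where b = "\<lambda>i. 0 < P p i $ 2"])
      show "side (0 < P p i $ 2) (P q i)" for i
        using Box_side[OF 2[OF q, of i]] same by (simp add: P_def)
    qed (use 1 2 p q Box_box Box_side in auto)
    also have "\<bar>P p 0 $ 1 - P q 0 $ 1\<bar> \<le> 8" using 2[OF p, of 0] 2[OF q, of 0] by (auto simp: Box_def)
    finally show ?thesis by (simp add: P_def)
  qed
  moreover have "(\<lambda>n. 816 * (51 / 100 :: real) ^ n) \<longlonglongrightarrow> 816 * 0"
    by (intro tendsto_mult tendsto_const LIMSEQ_power_zero) simp
  ultimately have "norm (p - q) \<le> 816 * 0" by (intro LIMSEQ_le_const[of _ "816 * 0"]) blast+
  then show ?thesis by simp
qed

text \<open>Every bi-infinite sequence of signs is the itinerary of a point. The orbit equation is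
\<open>y\<^sub>j\<^sup>2 = 9.5 + y\<^sub>j\<^sub>+\<^sub>1 - 0.3 y\<^sub>j\<^sub>-\<^sub>1\<close>, and with the sign prescribed it becomes a contraction, after the radicand has been
clipped to the range \<open>[2.05\<^sup>2, 16]\<close>, which the solution turns out to respect. Then \<open>z\<close> is found from
\<open>z\<^sub>j = (z\<^sub>j\<^sub>+\<^sub>1 - y\<^sub>j) / \<xi>\<close>.\<close>
lemma itinerary_exists:
  obtains p where "p \<in> \<Lambda>" "\<And>j. 0 < orb p j $ 2 \<longleftrightarrow> s j"
proof -
  define \<sigma> :: "int \<Rightarrow> real" where "\<sigma> j = (if s j then 1 else -1)" for j
  define clip :: "real \<Rightarrow> real" where "clip t = max (1681 / 400) (min 16 t)" for t
  have clip_diff: "\<bar>sqrt (clip t) - sqrt (clip t')\<bar> \<le> \<bar>t - t'\<bar> * (10 / 41)" for t t'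
  proof -
    have s: "41 / 20 \<le> sqrt (clip t)" for t
      by (rule real_le_rsqrt) (simp add: clip_def power2_eq_square)
    have "\<bar>sqrt (clip t) - sqrt (clip t')\<bar> * (41 / 10) \<le> \<bar>sqrt (clip t) - sqrt (clip t')\<bar> * \<bar>sqrt (clip t) + sqrt (clip t')\<bar>"
      using s[of t] s[of t'] by (intro mult_left_mono) auto
    also have "\<dots> = \<bar>(sqrt (clip t))\<^sup>2 - (sqrt (clip t'))\<^sup>2\<bar>"
      by (simp add: power2_eq_square algebra_simps flip: abs_mult)
    also have "\<dots> = \<bar>clip t - clip t'\<bar>" by (simp add: clip_def)
    also have "\<dots> \<le> \<bar>t - t'\<bar>" unfolding clip_def by (auto simp: max_def min_def)
    finally show ?thesis by simp
  qed
  have y_lip: "\<bar>\<sigma> j * sqrt (clip (19 / 2 + a - 3 / 10 * b)) - \<sigma> j * sqrt (clip (19 / 2 + a' - 3 / 10 * b'))\<bar>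
      \<le> 1 / 2 * max \<bar>a - a'\<bar> \<bar>b - b'\<bar>" for j a b a' b'
  proof -
    define M where "M = max \<bar>a - a'\<bar> \<bar>b - b'\<bar>"
    have M: "\<bar>a - a'\<bar> \<le> M" "\<bar>b - b'\<bar> \<le> M" unfolding M_def by auto
    have "\<bar>\<sigma> j * sqrt (clip (19 / 2 + a - 3 / 10 * b)) - \<sigma> j * sqrt (clip (19 / 2 + a' - 3 / 10 * b'))\<bar>
      = \<bar>sqrt (clip (19 / 2 + a - 3 / 10 * b)) - sqrt (clip (19 / 2 + a' - 3 / 10 * b'))\<bar>"
      by (simp add: \<sigma>_def abs_minus_commute)
    also have "\<dots> \<le> \<bar>(19 / 2 + a - 3 / 10 * b) - (19 / 2 + a' - 3 / 10 * b')\<bar> * (10 / 41)" by (rule clip_diff)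
    also have "\<dots> \<le> (13 / 10 * M) * (10 / 41)"
      using M unfolding abs_le_iff by (intro mult_right_mono abs_leI) linarith+
    also have "\<dots> \<le> 1 / 2 * M" using M(1) by linarith
    finally show "\<bar>\<sigma> j * sqrt (clip (19 / 2 + a - 3 / 10 * b)) - \<sigma> j * sqrt (clip (19 / 2 + a' - 3 / 10 * b'))\<bar>
      \<le> 1 / 2 * max \<bar>a - a'\<bar> \<bar>b - b'\<bar>" unfolding M_def .
  qed
  have y_bdd: "\<bar>\<sigma> j * sqrt (clip (19 / 2 + 0 - 3 / 10 * 0))\<bar> \<le> 4" for j
    by (simp add: abs_mult \<sigma>_def clip_def real_le_lsqrt)
  have "\<exists>y B. (\<forall>j. \<bar>y j\<bar> \<le> B) \<and> (\<forall>j. y j = \<sigma> j * sqrt (clip (19 / 2 + y (j + 1) - 3 / 10 * y (j - 1))))"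
    by (rule bounded_solution[of "1 / 2"]) (simp, simp, rule y_lip, rule y_bdd)
  then obtain y where y: "\<And>j. y j = \<sigma> j * sqrt (clip (19 / 2 + y (j + 1) - 3 / 10 * y (j - 1)))"
    by (elim exE conjE) (rule that, erule spec)
  have y_abs: "\<bar>y j\<bar> = sqrt (clip (19 / 2 + y (j + 1) - 3 / 10 * y (j - 1)))" for j
  proof -
    have "0 \<le> sqrt (clip t)" for t by (simp add: clip_def)
    then show ?thesis by (subst y) (simp add: \<sigma>_def abs_mult)
  qed
  have yb: "41 / 20 \<le> \<bar>y j\<bar>" "\<bar>y j\<bar> \<le> 4" for j
    unfolding y_abs by (rule real_le_rsqrt, simp add: clip_def power2_eq_square,
        rule real_le_lsqrt, simp_all add: clip_def power2_eq_square)
  have "clip (19 / 2 + y (j + 1) - 3 / 10 * y (j - 1)) = 19 / 2 + y (j + 1) - 3 / 10 * y (j - 1)" for j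
    using yb(2)[of "j + 1"] yb(2)[of "j - 1"] unfolding clip_def by (auto simp: max_def min_def)
  then have y_rec: "(y j)\<^sup>2 = 19 / 2 + y (j + 1) - 3 / 10 * y (j - 1)" for j
    using y_abs[of j] yb(1)[of j] by (metis abs_ge_zero power2_abs real_sqrt_ge_0_iff real_sqrt_pow2)
  have y_sign: "0 < y j \<longleftrightarrow> s j" for j
  proof -
    have e: "y j = \<sigma> j * \<bar>y j\<bar>" unfolding y_abs by (rule y)
    show ?thesis
    proof (cases "s j")
      case True
      then have "\<sigma> j = 1" by (simp add: \<sigma>_def)
      then have "0 < y j" using e[unfolded \<open>\<sigma> j = 1\<close>] yb(1)[of j] by linarith
      with True show ?thesis by simp
    next
      case False
      then have "\<sigma> j = - 1" by (simp add: \<sigma>_def)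
      then have "y j < 0" using e[unfolded \<open>\<sigma> j = - 1\<close>] yb(1)[of j] by linarith
      with False show ?thesis by simp
    qed
  qed
  have z_lip: "\<bar>(a - y j) / \<xi> - (a' - y j) / \<xi>\<bar> \<le> 1 / \<xi> * max \<bar>a - a'\<bar> \<bar>b - b'\<bar>" for j a b a' b'
    using xi_pos(1) by (rule divide_lipschitz)
  have z_bdd: "\<bar>(0 - y j) / \<xi>\<bar> \<le> 4" for j
    using xi yb(2) by (intro divide_bound) auto
  have "\<exists>z C. (\<forall>j. \<bar>z j\<bar> \<le> C) \<and> (\<forall>j. z j = (z (j + 1) - y j) / \<xi>)"
    by (rule bounded_solution[of "1 / \<xi>"]) (use xi_pos in simp, use xi_pos in simp, rule z_lip, rule z_bdd)
  then obtain z C where zC: "\<And>j. \<bar>z j\<bar> \<le> C" and z: "\<And>j. z j = (z (j + 1) - y j) / \<xi>"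
    by (elim exE conjE) (rule that; erule spec)
  have zb: "\<bar>z j\<bar> \<le> 400" for j
  proof -
    have bdd: "bdd_above (range (\<lambda>j. \<bar>z j\<bar>))" using zC by (auto simp: bdd_above_def)
    define S where "S = (SUP j. \<bar>z j\<bar>)"
    have zS: "\<bar>z j\<bar> \<le> S" for j unfolding S_def by (rule cSUP_upper[OF _ bdd]) simp
    have "\<bar>z j\<bar> \<le> (S + 4) / \<xi>" for j
    proof -
      have "\<bar>z j\<bar> = \<bar>z (j + 1) - y j\<bar> / \<xi>" by (subst z) (use xi_pos(1) in \<open>simp add: abs_divide\<close>)
      also have "\<dots> \<le> (S + 4) / \<xi>"
        using zS[of "j + 1"] yb(2)[of j] xi_pos(1) by (intro divide_right_mono) linarith+
      finally show ?thesis .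
    qed
    then have "S \<le> (S + 4) / \<xi>" unfolding S_def by (intro cSUP_least) auto
    then have "S * \<xi> \<le> S + 4" using xi_pos(1) by (simp only: pos_le_divide_eq)
    then have "(\<xi> - 1) * S \<le> 4" by (simp add: algebra_simps)
    moreover have "1 / 100 * S \<le> (\<xi> - 1) * S" using xi zS[of 0] by (intro mult_right_mono) auto
    ultimately show ?thesis using zS[of j] by linarith
  qed
  define q :: "int \<Rightarrow> real ^ 3" where "q j = vector [y (j - 1), y j, z j]" for j
  have "q (j + 1) = f (q j)" for j
    by (rule vector3_eqI) (use y_rec[of j] z[of j] xi_pos in \<open>simp_all add: q_def vector_3 field_simps\<close>)
  then have orb: "orb (q 0) j = q j" for j using orb_unique[of q j] by simp
  show ?thesis
  proof (rule that[of "q 0"])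
    have "q j \<in> Box" for j using yb zb by (simp add: Box_def q_def vector_3)
    then show "q 0 \<in> \<Lambda>" by (simp add: \<Lambda>_def orb)
    show "0 < orb (q 0) j $ 2 \<longleftrightarrow> s j" for j unfolding orb by (simp add: q_def vector_3 y_sign)
  qed
qed

text \<open>A point whose itinerary contains every finite word has a dense forward orbit: by compactness and uniqueness of itineraries, agreement
of the codes on long windows forces convergence.\<close>
lemma transitive_\<Lambda>: "transitive_set f \<Lambda>"
proof -
  obtain s :: "int \<Rightarrow> bool" where s: "\<And>w n. \<exists>k::nat. \<forall>i. \<bar>i\<bar> \<le> int n \<longrightarrow> s (int k + i) = w i"
    by (rule universal_sequence) (rule that)
  obtain x where x: "x \<in> \<Lambda>" and xs: "\<And>j. 0 < orb x j $ 2 \<longleftrightarrow> s j" by (rule itinerary_exists[of s]) (rule that)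
  have "v \<in> closure {(f ^^ j) x |j. True}" if v: "v \<in> \<Lambda>" for v
  proof -
    obtain k where k: "\<And>n i. \<bar>i\<bar> \<le> int n \<Longrightarrow> s (int (k n) + i) \<longleftrightarrow> 0 < orb v i $ 2"
      using s[of _ "\<lambda>i. 0 < orb v i $ 2"] by metis
    have "\<forall>n. orb x (int (k n)) \<in> \<Lambda>" using orb_in_\<Lambda>[OF x] by simp
    then obtain l r where l: "l \<in> \<Lambda>" and r: "strict_mono r" and lim: "((\<lambda>n. orb x (int (k n))) \<circ> r) \<longlonglongrightarrow> l"
      using compact_\<Lambda> unfolding compact_def by metis
    have "l = v"
    proof (rule itinerary_unique[OF l v])
      fix j
      have "isCont (\<lambda>p. orb p j) l" using continuous_orb by (simp add: continuous_on_eq_continuous_at)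
      then have "(\<lambda>n. orb (orb x (int (k (r n)))) j) \<longlonglongrightarrow> orb l j"
        using isCont_tendsto_compose[OF _ lim] by (simp add: o_def)
      then have lim2: "(\<lambda>n. orb x (int (k (r n)) + j) $ 2) \<longlonglongrightarrow> orb l j $ 2"
        unfolding orb_orb by (rule tendsto_vec_nth)
      have ev: "eventually (\<lambda>n. 0 < orb x (int (k (r n)) + j) $ 2 \<longleftrightarrow> 0 < orb v j $ 2) sequentially"
        unfolding eventually_sequentially
      proof (intro exI[of _ "nat \<bar>j\<bar>"] allI impI)
        fix n assume "nat \<bar>j\<bar> \<le> n"
        then have "\<bar>j\<bar> \<le> int (r n)" using seq_suble[OF r, of n] by linarith
        then show "0 < orb x (int (k (r n)) + j) $ 2 \<longleftrightarrow> 0 < orb v j $ 2" unfolding xs by (rule k)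
      qed
      have abs: "41 / 20 \<le> \<bar>orb x i $ 2\<bar>" for i using \<Lambda>_orb_Box[OF x, of i] by (simp add: Box_def)
      have pos: "41 / 20 \<le> orb x i $ 2" if "0 < orb x i $ 2" for i using abs[of i] that by linarith
      have neg: "orb x i $ 2 \<le> - (41 / 20)" if "\<not> 0 < orb x i $ 2" for i using abs[of i] that by linarith
      show "0 < orb l j $ 2 \<longleftrightarrow> 0 < orb v j $ 2"
      proof (cases "0 < orb v j $ 2")
        case True
        have "eventually (\<lambda>n. 41 / 20 \<le> orb x (int (k (r n)) + j) $ 2) sequentially"
          by (rule eventually_mono[OF ev]) (use pos True in blast)
        then have "41 / 20 \<le> orb l j $ 2" by (rule tendsto_lowerbound[OF lim2]) simp
        with True show ?thesis by linarith
      next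
        case False
        have "eventually (\<lambda>n. orb x (int (k (r n)) + j) $ 2 \<le> - (41 / 20)) sequentially"
          by (rule eventually_mono[OF ev]) (use neg False in blast)
        then have "orb l j $ 2 \<le> - (41 / 20)" by (rule tendsto_upperbound[OF lim2]) simp
        with False show ?thesis by linarith
      qed
    qed
    with lim show ?thesis unfolding closure_sequential
      by (intro exI[of _ "(\<lambda>n. orb x (int (k n))) \<circ> r"]) (auto simp: orb_nat)
  qed
  with x show ?thesis unfolding transitive_set_def by blast
qed

end

section \<open>Hyperbolicity\<close>

lemma subspace_bounded_orbits:
  fixes L :: "nat \<Rightarrow> 'a::real_vector \<Rightarrow> 'b::real_normed_vector"
  assumes L: "\<And>n. linear (L n)"
  shows "subspace {v. \<exists>C. \<forall>n. norm (L n v) \<le> C}"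
proof (rule subspaceI)
  show "0 \<in> {v. \<exists>C. \<forall>n. norm (L n v) \<le> C}" using linear_0[OF L] by auto
next
  fix x y assume "x \<in> {v. \<exists>C. \<forall>n. norm (L n v) \<le> C}" "y \<in> {v. \<exists>C. \<forall>n. norm (L n v) \<le> C}"
  then obtain C D where C: "\<And>n. norm (L n x) \<le> C" and D: "\<And>n. norm (L n y) \<le> D" by auto
  have "norm (L n (x + y)) \<le> C + D" for n
    unfolding linear_add[OF L] using C D by (intro norm_triangle_le add_mono)
  then show "x + y \<in> {v. \<exists>C. \<forall>n. norm (L n v) \<le> C}" by blast
next
  fix c x assume "x \<in> {v. \<exists>C. \<forall>n. norm (L n v) \<le> C}"
  then obtain C where C: "\<And>n. norm (L n x) \<le> C" by auto
  have "norm (L n (c *\<^sub>R x)) \<le> \<bar>c\<bar> * C" for n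
    unfolding linear_scale[OF L] using C by (simp add: mult_left_mono)
  then show "c *\<^sub>R x \<in> {v. \<exists>C. \<forall>n. norm (L n v) \<le> C}" by blast
qed

context henon
begin

text \<open>The derivatives of the iterates, as products along the orbit; likewise for the inverse.\<close>
primrec DFn :: "nat \<Rightarrow> real ^ 3 \<Rightarrow> real ^ 3 \<Rightarrow> real ^ 3" where
  "DFn 0 p v = v"
| "DFn (Suc n) p v = Df ((f ^^ n) p) (DFn n p v)"

primrec DGn :: "nat \<Rightarrow> real ^ 3 \<Rightarrow> real ^ 3 \<Rightarrow> real ^ 3" where
  "DGn 0 p v = v"
| "DGn (Suc n) p v = Dg ((finv ^^ n) p) (DGn n p v)"

lemma DFn_has_derivative: "((f ^^ n) has_derivative DFn n p) (at p)"
proof (induction n)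
  case 0
  have "DFn 0 p = (\<lambda>v. v)" by auto
  then show ?case by (simp add: id_def)
next
  case (Suc n)
  have "DFn (Suc n) p = (\<lambda>v. Df ((f ^^ n) p) (DFn n p v))" by auto
  with has_derivative_compose[OF Suc f_has_derivative] show ?case by (simp add: o_def)
qed

lemma DGn_has_derivative: "((finv ^^ n) has_derivative DGn n p) (at p)"
proof (induction n)
  case 0
  have "DGn 0 p = (\<lambda>v. v)" by auto
  then show ?case by (simp add: id_def)
next
  case (Suc n)
  have "DGn (Suc n) p = (\<lambda>v. Dg ((finv ^^ n) p) (DGn n p v))" by auto
  with has_derivative_compose[OF Suc finv_has_derivative] show ?case by (simp add: o_def)
qed

lemma DFn_swap: "DFn (Suc n) p v = DFn n (f p) (Df p v)"
  by (induction n) (simp_all add: funpow_swap1)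

lemma DGn_swap: "DGn (Suc n) (f p) (Df p v) = DGn n p v"
proof (induction n)
  case (Suc n)
  have "(finv ^^ Suc n) (f p) = (finv ^^ n) p" unfolding funpow_Suc_right by simp
  with Suc show ?case by simp
qed simp

text \<open>The stable space consists of the tangent vectors with bounded forward orbit, the unstable space of those with bounded
backward orbit. Invariance is then immediate, and exponential rates follow from the cone estimates.\<close>
definition Es :: "real ^ 3 \<Rightarrow> (real ^ 3) set" where
  "Es p = {v. \<exists>C. \<forall>n. norm (DFn n p v) \<le> C}"

definition Eu :: "real ^ 3 \<Rightarrow> (real ^ 3) set" where
  "Eu p = {v. \<exists>C. \<forall>n. norm (DGn n p v) \<le> C}"

lemma subspace_Es: "subspace (Es p)" unfolding Es_def
  using DFn_has_derivative has_derivative_linear by (intro subspace_bounded_orbits) blast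

lemma subspace_Eu: "subspace (Eu p)" unfolding Eu_def
  using DGn_has_derivative has_derivative_linear by (intro subspace_bounded_orbits) blast

lemma Es_iff: "Df p v \<in> Es (f p) \<longleftrightarrow> v \<in> Es p"
proof
  assume "Df p v \<in> Es (f p)"
  then obtain C where C: "\<And>n. norm (DFn (Suc n) p v) \<le> C" unfolding Es_def DFn_swap by auto
  have "norm (DFn n p v) \<le> max C (norm v)" for n
    using C[of "n - 1"] by (cases n) (auto simp del: DFn.simps(2))
  then show "v \<in> Es p" unfolding Es_def by blast
qed (auto simp: Es_def DFn_swap[symmetric] simp del: DFn.simps)

lemma Eu_iff: "Df p v \<in> Eu (f p) \<longleftrightarrow> v \<in> Eu p"
proof
  assume "v \<in> Eu p"
  then obtain C where C: "\<And>n. norm (DGn (Suc n) (f p) (Df p v)) \<le> C" unfolding Eu_def DGn_swap by auto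
  have "norm (DGn n (f p) (Df p v)) \<le> max C (norm (Df p v))" for n
    using C[of "n - 1"] by (cases n) (auto simp del: DGn.simps(2))
  then show "Df p v \<in> Eu (f p)" unfolding Eu_def by blast
next
  assume "Df p v \<in> Eu (f p)"
  then obtain C where C: "\<And>n. norm (DGn n (f p) (Df p v)) \<le> C" unfolding Eu_def by auto
  have "norm (DGn n p v) \<le> C" for n using C[of "Suc n"] unfolding DGn_swap .
  then show "v \<in> Eu p" unfolding Eu_def by blast
qed

lemma Df_image_Es: "Df p ` Es p = Es (f p)"
proof
  show "Es (f p) \<subseteq> Df p ` Es p"
    using Es_iff[of p] by (metis Df_Dg imageI subsetI)
qed (use Es_iff in auto)

lemma Df_image_Eu: "Df p ` Eu p = Eu (f p)"
proof
  show "Eu (f p) \<subseteq> Df p ` Eu p"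
    using Eu_iff[of p] by (metis Df_Dg imageI subsetI)
qed (use Eu_iff in auto)

lemma Es_estimate:
  assumes p: "p \<in> \<Lambda>" and v: "v \<in> Es p"
  shows "\<bar>v $ 2\<bar> \<le> \<bar>v $ 1\<bar> / 2" "\<bar>v $ 3\<bar> \<le> 100 * \<bar>v $ 1\<bar>"
    and "norm (DFn n p v) \<le> 102 * (51 / 100) ^ n * norm v"
proof -
  obtain C where C: "\<And>n. norm (DFn n p v) \<le> C" using v unfolding Es_def by auto
  have comp: "\<bar>DFn n p v $ i\<bar> \<le> C" for n i using component_le_norm_cart C by (rule order.trans)
  define x y z a where "x n = DFn n p v $ 1" and "y n = DFn n p v $ 2"
    and "z n = DFn n p v $ 3" and "a n = 2 * (f ^^ n) p $ 2" for n
  have a: "4 \<le> \<bar>a n\<bar>" for n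
    using \<Lambda>_orb_Box[OF p, of "int n"] unfolding a_def orb_nat by (auto simp: Box_def abs_mult)
  have cone: "\<bar>y n\<bar> \<le> \<bar>x n\<bar> / 2" "\<bar>z n\<bar> \<le> 100 * \<bar>x n\<bar>" "\<bar>x (Suc n)\<bar> \<le> 51 / 100 * \<bar>x n\<bar>" for n
    by (rule cone_forward[of \<xi> a x y z C, OF xi(1) a];
        use comp in \<open>simp add: x_def y_def z_def a_def\<close>)+
  show "\<bar>v $ 2\<bar> \<le> \<bar>v $ 1\<bar> / 2" "\<bar>v $ 3\<bar> \<le> 100 * \<bar>v $ 1\<bar>"
    using cone(1,2)[of 0] by (simp_all add: x_def y_def z_def)
  have xn: "\<bar>x n\<bar> \<le> (51 / 100) ^ n * \<bar>v $ 1\<bar>"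
  proof (induction n)
    case (Suc n) with cone(3)[of n] show ?case by simp
  qed (simp add: x_def)
  have "norm (DFn n p v) \<le> \<bar>x n\<bar> + \<bar>y n\<bar> + \<bar>z n\<bar>"
    using norm_le_sum3 unfolding x_def y_def z_def by simp
  also have "\<dots> \<le> 102 * \<bar>x n\<bar>" using cone(1,2)[of n] by simp
  also have "\<dots> \<le> 102 * ((51 / 100) ^ n * norm v)"
    using order.trans[OF xn mult_left_mono[OF component_le_norm_cart[of v 1]]] by simp
  finally show "norm (DFn n p v) \<le> 102 * (51 / 100) ^ n * norm v" by simp
qed

lemma Eu_estimate:
  assumes p: "p \<in> \<Lambda>" and v: "v \<in> Eu p"
  shows "\<bar>v $ 1\<bar> \<le> \<bar>v $ 2\<bar> / 2"
    and "norm (DGn n p v) \<le> 3 * (1 / \<xi>) ^ n * norm v"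
proof -
  obtain C where C: "\<And>n. norm (DGn n p v) \<le> C" using v unfolding Eu_def by auto
  have comp: "\<bar>DGn n p v $ i\<bar> \<le> C" for n i using component_le_norm_cart C by (rule order.trans)
  define x y z a where "x n = DGn n p v $ 1" and "y n = DGn n p v $ 2"
    and "z n = DGn n p v $ 3" and "a n = 2 * (finv ^^ Suc n) p $ 2" for n
  have a: "4 \<le> \<bar>a n\<bar>" for n
    using \<Lambda>_orb_Box[OF p, of "- int (Suc n)"] unfolding a_def orb_minus_nat by (auto simp: Box_def abs_mult)
  have D: "DGn n p v = Df ((finv ^^ Suc n) p) (DGn (Suc n) p v)" for n
    using Df_Dg[of "(finv ^^ Suc n) p" "DGn n p v"] by simp
  have XYZ: "x n = y (Suc n)" "y n = a n * y (Suc n) + 3 / 10 * x (Suc n)" "z n = \<xi> * z (Suc n) + y (Suc n)" for n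
    unfolding x_def y_def z_def a_def by (subst D; simp only: Df_nth)+
  have cone: "\<bar>x n\<bar> \<le> \<bar>y n\<bar> / 2" "\<bar>z n\<bar> + 2 * \<bar>y n\<bar> \<le> (1 / \<xi>) ^ n * (\<bar>z 0\<bar> + 2 * \<bar>y 0\<bar>)" for n
    by (rule cone_backward[of \<xi> a x y z C, OF _ _ a XYZ]; use xi comp in \<open>simp add: x_def\<close>)+
  show "\<bar>v $ 1\<bar> \<le> \<bar>v $ 2\<bar> / 2" using cone(1)[of 0] by (simp add: x_def y_def)
  have "norm (DGn n p v) \<le> \<bar>x n\<bar> + \<bar>y n\<bar> + \<bar>z n\<bar>"
    using norm_le_sum3 unfolding x_def y_def z_def by simp
  also have "\<dots> \<le> \<bar>z n\<bar> + 2 * \<bar>y n\<bar>" using cone(1)[of n] by simp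
  also have "\<dots> \<le> (1 / \<xi>) ^ n * (\<bar>v $ 3\<bar> + 2 * \<bar>v $ 2\<bar>)" using cone(2)[of n] by (simp add: y_def z_def)
  also have "\<dots> \<le> (1 / \<xi>) ^ n * (3 * norm v)"
    using component_le_norm_cart[of v 3] component_le_norm_cart[of v 2] xi_pos by (intro mult_left_mono) auto
  finally show "norm (DGn n p v) \<le> 3 * (1 / \<xi>) ^ n * norm v" by (simp add: mult_ac)
qed

lemma Eu_Es_trivial:
  assumes "p \<in> \<Lambda>" "v \<in> Eu p" "v \<in> Es p" shows "v = 0"
proof -
  have "v $ 1 = 0" using Es_estimate(1)[OF assms(1,3)] Eu_estimate(1)[OF assms(1,2)] by linarith
  then show ?thesis
    using Es_estimate(1,2)[OF assms(1,3)] by (intro vector3_eqI) auto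
qed

text \<open>The direction of \<open>y\<close> lies in the sum of the two spaces. The linearised equation with a single source term of size \<open>b\<close>, placed at
time \<open>- 1\<close>, has a bounded bi-infinite solution \<open>u\<close>. Its part after the source is a bounded forward orbit, its part before the source a
bounded backward orbit, and at time 0 the two differ by \<open>(0, b, 0)\<close>.\<close>
lemma Eu_Es_vertical:
  assumes p: "p \<in> \<Lambda>"
  shows "\<exists>u s. u \<in> Eu p \<and> s \<in> Es p \<and> vector [0, b, 0] = u + s"
proof -
  define a where "a j = 2 * orb p j $ 2" for j
  define \<beta> :: "int \<Rightarrow> real" where "\<beta> j = (if j = - 1 then b else 0)" for j
  have a: "4 \<le> \<bar>a j\<bar>" for j using \<Lambda>_orb_Box[OF p, of j] by (auto simp: Box_def abs_mult a_def)
  have "\<exists>u C. (\<forall>j. \<bar>u j\<bar> \<le> C) \<and> (\<forall>j. u j = (\<beta> j + u (j + 1) - 3 / 10 * u (j - 1)) / a j)"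
  proof (rule bounded_solution[of "1 / 2" _ "\<bar>b\<bar>"])
    fix j :: int and r s r' s' :: real
    define M where "M = max \<bar>r - r'\<bar> \<bar>s - s'\<bar>"
    have M: "\<bar>r - r'\<bar> \<le> M" "\<bar>s - s'\<bar> \<le> M" unfolding M_def by auto
    have "\<bar>(\<beta> j + r - 3 / 10 * s) - (\<beta> j + r' - 3 / 10 * s')\<bar> \<le> 2 * M"
      using M[unfolded abs_le_iff] by (intro abs_leI) linarith+
    also have "\<dots> \<le> 1 / 2 * M * \<bar>a j\<bar>" using mult_left_mono[OF a[of j], of "1 / 2 * M"] M(1) by simp
    finally have "\<bar>(\<beta> j + r - 3 / 10 * s) - (\<beta> j + r' - 3 / 10 * s')\<bar> / \<bar>a j\<bar> \<le> 1 / 2 * M"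
      using a[of j] by (simp add: divide_le_eq)
    then show "\<bar>(\<beta> j + r - 3 / 10 * s) / a j - (\<beta> j + r' - 3 / 10 * s') / a j\<bar> \<le> 1 / 2 * max \<bar>r - r'\<bar> \<bar>s - s'\<bar>"
      unfolding M_def diff_divide_distrib[symmetric] abs_divide .
    have "\<bar>b\<bar> * 1 \<le> \<bar>b\<bar> * \<bar>a j\<bar>" using a[of j] by (intro mult_left_mono) auto
    then have "\<bar>\<beta> j\<bar> \<le> \<bar>b\<bar> * \<bar>a j\<bar>" by (cases "j = - 1") (simp_all add: \<beta>_def)
    moreover have "0 < \<bar>a j\<bar>" using a[of j] by linarith
    ultimately have "\<bar>\<beta> j\<bar> / \<bar>a j\<bar> \<le> \<bar>b\<bar>" by (simp only: pos_divide_le_eq)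
    then show "\<bar>(\<beta> j + 0 - 3 / 10 * 0) / a j\<bar> \<le> \<bar>b\<bar>" by (simp add: abs_divide)
  qed auto
  then obtain u C where uC: "\<And>j. \<bar>u j\<bar> \<le> C" and u_eq: "\<And>j. u j = (\<beta> j + u (j + 1) - 3 / 10 * u (j - 1)) / a j"
    by (elim exE conjE) (rule that; erule spec)
  have u: "a j * u j = \<beta> j + u (j + 1) - 3 / 10 * u (j - 1)" for j
  proof -
    have "a j \<noteq> 0" using a[of j] by auto
    then have "a j * (t / a j) = t" for t by simp
    then show ?thesis by (subst u_eq)
  qed
  have "\<exists>z D. (\<forall>j. \<bar>z j\<bar> \<le> D) \<and> (\<forall>j. z j = (z (j + 1) - u j) / \<xi>)"
  proof (rule bounded_solution[of "1 / \<xi>" _ C])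
    fix j :: int and r s r' s' :: real
    show "\<bar>(r - u j) / \<xi> - (r' - u j) / \<xi>\<bar> \<le> 1 / \<xi> * max \<bar>r - r'\<bar> \<bar>s - s'\<bar>"
      using xi_pos(1) by (rule divide_lipschitz)
    show "\<bar>(0 - u j) / \<xi>\<bar> \<le> C" using xi uC by (intro divide_bound) auto
  qed (use xi_pos in auto)
  then obtain z D where zD: "\<And>j. \<bar>z j\<bar> \<le> D" and z_eq: "\<And>j. z j = (z (j + 1) - u j) / \<xi>"
    by (elim exE conjE) (rule that; erule spec)
  have z: "\<xi> * z j = z (j + 1) - u j" for j
    by (subst z_eq) (use xi_pos(3) in simp)
  define w :: "int \<Rightarrow> real ^ 3" where "w j = vector [u (j - 1), u j, z j]" for j
  have bdd: "norm (w j) \<le> 2 * C + D" for j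
    using norm_le_sum3[of "w j"] uC[of j] uC[of "j - 1"] zD[of j] by (simp add: w_def vector_3)
  have Dw: "Df (orb p j) (w j) = w (j + 1) + vector [0, \<beta> j, 0]" for j
    by (rule vector3_eqI) (use u[of j] z[of j] in \<open>simp_all add: w_def vector_3 a_def\<close>)
  have v0: "vector [0, 0, 0] = (0 :: real ^ 3)" by (rule vector3_eqI) (simp_all add: vector_3)
  have fwd: "DFn n p (w 0) = w (int n)" for n
  proof (induction n)
    case (Suc n)
    then show ?case using Dw[of "int n"] by (simp add: orb_nat \<beta>_def v0 add.commute)
  qed simp
  then have s: "w 0 \<in> Es p" unfolding Es_def using bdd by auto
  have bwd: "DGn n (orb p (- 1)) (w (- 1)) = w (- 1 - int n)" for n
  proof (induction n)
    case (Suc n)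
    have "(finv ^^ n) (orb p (- 1)) = orb p (- 1 - int n)"
      using orb_orb[of p "- 1" "- int n"] by (simp add: orb_minus_nat)
    also have "\<dots> = f (orb p (- 1 - int (Suc n)))" using orb_add1[of p "- 1 - int (Suc n)"] by simp
    finally have "(finv ^^ n) (orb p (- 1)) = f (orb p (- 1 - int (Suc n)))" .
    moreover have "w (- 1 - int n) = Df (orb p (- 1 - int (Suc n))) (w (- 1 - int (Suc n)))"
      using Dw[of "- 1 - int (Suc n)"] by (simp add: \<beta>_def v0)
    ultimately show ?case using Suc by simp
  qed simp
  have "w (- 1) \<in> Eu (orb p (- 1))" unfolding Eu_def using bwd bdd by auto
  then have "Df (orb p (- 1)) (w (- 1)) \<in> Eu (f (orb p (- 1)))" by (simp add: Eu_iff)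
  then have "w 0 + vector [0, b, 0] \<in> Eu p"
    using Dw[of "- 1"] orb_add1[of p "- 1"] by (simp add: \<beta>_def)
  moreover have "- w 0 \<in> Es p" using s subspace_neg[OF subspace_Es] by blast
  moreover have "vector [0, b, 0] = (w 0 + vector [0, b, 0]) + - w 0" by simp
  ultimately show ?thesis by blast
qed

lemma Eu_central: "vector [0, 0, c] \<in> Eu p"
proof -
  have D: "DGn n p (vector [0, 0, c]) = vector [0, 0, c / \<xi> ^ n]" for n
    by (induction n) (auto intro!: vector3_eqI simp: vector_3)
  have "norm (vector [0, 0, c / \<xi> ^ n] :: real ^ 3) \<le> \<bar>c\<bar>" for n
  proof -
    have "norm (vector [0, 0, c / \<xi> ^ n] :: real ^ 3) \<le> \<bar>c / \<xi> ^ n\<bar>"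
      using norm_le_sum3[of "vector [0, 0, c / \<xi> ^ n]"] by (simp add: vector_3)
    also have "\<dots> \<le> \<bar>c\<bar>"
    proof -
      have "1 \<le> \<xi> ^ n" using xi_pos by (intro one_le_power) auto
      then have "\<bar>c\<bar> * 1 \<le> \<bar>c\<bar> * \<xi> ^ n" by (intro mult_left_mono) auto
      then show ?thesis using xi_pos(1) by (simp add: abs_divide pos_divide_le_eq)
    qed
    finally show ?thesis .
  qed
  then show ?thesis by (auto simp: Eu_def D)
qed

text \<open>The remaining direction \<open>(1, 0, 0)\<close> comes from the image of \<open>(0, 1, 0)\<close> under the derivative at the preimage.\<close>
lemma Eu_Es_sum:
  assumes p: "p \<in> \<Lambda>"
  shows "{u + s |u s. u \<in> Eu p \<and> s \<in> Es p} = UNIV"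
proof -
  define T where "T q = {u + s |u s. u \<in> Eu q \<and> s \<in> Es q}" for q
  have sub: "subspace (T q)" for q unfolding T_def by (rule subspace_sums[OF subspace_Eu subspace_Es])
  have vert: "vector [0, b, 0] \<in> T q" if "q \<in> \<Lambda>" for q b
    using Eu_Es_vertical[OF that, of b] unfolding T_def by blast
  have cent: "vector [0, 0, c] \<in> T p" for c
    unfolding T_def using Eu_central[of c p] subspace_0[OF subspace_Es, of p] by force
  define q where "q = orb p (- 1)"
  have q: "q \<in> \<Lambda>" "f q = p" using orb_in_\<Lambda>[OF p] orb_add1[of p "- 1"] by (auto simp: q_def)
  have "v \<in> T p" for v
  proof -
    obtain u s where us: "u \<in> Eu q" "s \<in> Es q" "vector [0, v $ 1, 0] = u + s"
      using Eu_Es_vertical[OF q(1)] by metis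
    have "Df q (vector [0, v $ 1, 0]) = Df q u + Df q s" unfolding us(3) by (rule linear_add[OF linear_Df])
    then have 1: "Df q (vector [0, v $ 1, 0]) \<in> T p"
      unfolding T_def using us(1,2) Eu_iff[of q u] Es_iff[of q s] q(2) by auto
    have "v = Df q (vector [0, v $ 1, 0]) + vector [0, v $ 2 - 2 * q $ 2 * v $ 1, 0] + vector [0, 0, v $ 3 - v $ 1]"
      by (rule vector3_eqI) (simp_all add: vector_3)
    moreover have "\<dots> \<in> T p" by (intro subspace_add[OF sub] 1 vert[OF p] cent)
    ultimately show ?thesis by simp
  qed
  then show ?thesis unfolding T_def by auto
qed

lemma splitting_\<Lambda>: "hyperbolic_splitting f \<Lambda> Eu Es"
proof -
  have Df: "frechet_derivative f (at p) = Df p" for p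
    using frechet_derivative_at[OF f_has_derivative] by simp
  have DFn: "frechet_derivative (f ^^ n) (at p) = DFn n p" for n p
    using frechet_derivative_at[OF DFn_has_derivative] by simp
  have DGn: "frechet_derivative (inv f ^^ n) (at p) = DGn n p" for n p
    using frechet_derivative_at[OF DGn_has_derivative] by (simp add: inv_f)
  have pos: "0 < (1 / \<xi>) ^ j * norm v" if "v \<noteq> 0" for j and v :: "real ^ 3" using that xi_pos by simp
  have eu: "norm (DGn j p v) < 1000 * (1 / \<xi>) ^ j * norm v" if p: "p \<in> \<Lambda>" and v: "v \<in> Eu p - {0}" for p j v
  proof -
    have "norm (DGn j p v) \<le> 3 * ((1 / \<xi>) ^ j * norm v)"
      using Eu_estimate(2)[OF p, of v j] v by (simp only: mult.assoc Diff_iff)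
    moreover have "0 < (1 / \<xi>) ^ j * norm v" using pos v by blast
    ultimately show ?thesis unfolding mult.assoc by linarith
  qed
  have es: "norm (DFn j p v) < 1000 * (1 / \<xi>) ^ j * norm v" if p: "p \<in> \<Lambda>" and v: "v \<in> Es p - {0}" for p j v
  proof -
    have "(51 / 100) ^ j \<le> (1 / \<xi>) ^ j" using xi by (intro power_mono) (auto simp: field_simps)
    then have "(51 / 100) ^ j * norm v \<le> (1 / \<xi>) ^ j * norm v" by (rule mult_right_mono) simp
    moreover have "norm (DFn j p v) \<le> 102 * ((51 / 100) ^ j * norm v)"
      using Es_estimate(3)[OF p, of v j] v by (simp only: mult.assoc Diff_iff)
    moreover have "0 < (1 / \<xi>) ^ j * norm v" using pos v by blast
    ultimately show ?thesis unfolding mult.assoc by linarith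
  qed
  have triv: "Eu p \<inter> Es p = {0}" if p: "p \<in> \<Lambda>" for p
    using Eu_Es_trivial[OF p] subspace_0[OF subspace_Es] subspace_0[OF subspace_Eu] by blast
  have r: "0 < 1 / \<xi>" "1 / \<xi> < 1" using xi_pos by auto
  show ?thesis unfolding hyperbolic_splitting_def Df DFn DGn
  proof (rule conjI)
    show "\<exists>c r. 0 < c \<and> 0 < r \<and> r < 1 \<and> (\<forall>p\<in>\<Lambda>. \<forall>j\<ge>1.
        (\<forall>v\<in>Eu p - {0}. norm (DGn j p v) < c * r ^ j * norm v) \<and>
        (\<forall>v\<in>Es p - {0}. norm (DFn j p v) < c * r ^ j * norm v))"
      by (rule exI[of _ 1000], rule exI[of _ "1 / \<xi>"]) (intro conjI ballI allI impI r eu es zero_less_numeral)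
  qed (intro ballI conjI subspace_Es subspace_Eu triv Eu_Es_sum Df_image_Es Df_image_Eu)
qed

lemma hyperbolic_\<Lambda>: "hyperbolic_set f \<Lambda>"
  unfolding hyperbolic_set_def using compact_\<Lambda> f_image_\<Lambda> splitting_\<Lambda> by blast

text \<open>Stable vectors are determined by their first component, and \<open>(1, 0, 0)\<close> is not unstable; so the stable spaces are lines.\<close>
lemma dim_Es:
  assumes p: "p \<in> \<Lambda>" shows "dim (Es p) = 1"
proof -
  obtain u s where us: "u \<in> Eu p" "s \<in> Es p" "vector [1, 0, 0] = u + s"
  proof -
    have "vector [1, 0, 0] \<in> {u + s |u s. u \<in> Eu p \<and> s \<in> Es p}" unfolding Eu_Es_sum[OF p] by simp
    then show ?thesis using that by blast
  qed
  have s1: "s $ 1 \<noteq> 0"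
  proof
    assume 0: "s $ 1 = 0"
    then have "s = 0" using Es_estimate(1,2)[OF p us(2)] by (intro vector3_eqI) auto
    then have "u = vector [1, 0, 0]" using us(3) by simp
    then show False using Eu_estimate(1)[OF p us(1)] by (simp add: vector_3)
  qed
  have "w \<in> span {s}" if w: "w \<in> Es p" for w
  proof -
    define d where "d = w - (w $ 1 / s $ 1) *\<^sub>R s"
    have d: "d \<in> Es p" unfolding d_def
      by (intro subspace_diff subspace_scale subspace_Es w us(2))
    have "d $ 1 = 0" using s1 by (simp add: d_def)
    then have "d = 0" using Es_estimate(1,2)[OF p d] by (intro vector3_eqI) auto
    then have "w = (w $ 1 / s $ 1) *\<^sub>R s" by (simp add: d_def)
    then show ?thesis by (metis span_base span_scale insertI1)
  qed
  moreover have "span {s} \<subseteq> Es p" using us(2) by (intro span_minimal subspace_Es) auto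
  ultimately have "Es p = span {s}" by auto
  moreover have "s \<noteq> 0" using s1 by auto
  ultimately show ?thesis by (simp add: dim_singleton)
qed

lemma stable_dim_\<Lambda>: "stable_dim f \<Lambda> 1"
  unfolding stable_dim_def using splitting_\<Lambda> dim_Es by blast

end

section \<open>Curves in the strong unstable cone\<close>

text \<open>One step of the cone estimate for differences \<open>(x, y, z)\<close> of two points of an admissible set, where \<open>ay\<close> and \<open>xz\<close> stand for the products
\<open>a y\<close> and \<open>\<xi> z\<close>, and \<open>(d1, d2, d3)\<close> is the difference of the images.\<close>
lemma cone_arithmetic:
  fixes d1 d2 d3 x y z ay xz e :: real
  assumes d: "\<bar>d1 - y\<bar> \<le> e" "\<bar>d2 - (ay + 3 / 10 * x)\<bar> \<le> e" "\<bar>d3 - (xz + y)\<bar> \<le> e"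
    and e: "e \<le> \<bar>y\<bar> / 500000" and x: "\<bar>x\<bar> \<le> \<bar>y\<bar> / 3" and z: "\<bar>z\<bar> \<le> 2 / 5 * \<bar>y\<bar>"
    and ay: "4 * \<bar>y\<bar> \<le> \<bar>ay\<bar>" "\<bar>ay\<bar> \<le> 8 * \<bar>y\<bar>" and xz: "\<bar>xz\<bar> \<le> 9 / 8 * \<bar>z\<bar>"
  shows "\<bar>d1\<bar> \<le> \<bar>d2\<bar> / 3" "\<bar>d3\<bar> \<le> 2 / 5 * \<bar>d2\<bar>" "\<bar>d2\<bar> \<le> 10 * \<bar>y\<bar>"
proof -
  have 2: "389 / 100 * \<bar>y\<bar> \<le> \<bar>d2\<bar>" using d(2) e x ay(1) by linarith
  have 1: "\<bar>d1\<bar> \<le> 101 / 100 * \<bar>y\<bar>" using d(1) e by linarith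
  have 3: "\<bar>d3\<bar> \<le> 1451 / 1000 * \<bar>y\<bar>" using d(3) e xz z by linarith
  show "\<bar>d1\<bar> \<le> \<bar>d2\<bar> / 3" using 1 2 by linarith
  show "\<bar>d3\<bar> \<le> 2 / 5 * \<bar>d2\<bar>" using 3 2 by linarith
  show "\<bar>d2\<bar> \<le> 10 * \<bar>y\<bar>" using d(2) e x ay(2) by linarith
qed

context henon
begin

text \<open>The region in which the forward orbits that start on an admissible set can be kept.\<close>
definition strips :: "(real ^ 3) set" where
  "strips = {p. \<bar>p $ 1\<bar> \<le> 43 / 10 \<and> 2 \<le> \<bar>p $ 2\<bar> \<and> \<bar>p $ 2\<bar> \<le> 4 \<and> \<bar>p $ 3\<bar> \<le> 10}"

text \<open>An admissible set is the graph, over the interval \<open>[- 4, 4]\<close> of the coordinate \<open>y\<close>, of Lipschitz functions for \<open>x\<close> and \<open>z\<close> with constants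
1/3 and 2/5, that satisfies bounds on \<open>x\<close> and, at \<open>y = 0\<close>, on \<open>z\<close>. It stands for a curve in the strong
unstable cone. Working with point sets instead of parametrised curves avoids orientations and reparametrisations.\<close>
definition admissible :: "(real ^ 3) set \<Rightarrow> bool" where
  "admissible C \<longleftrightarrow>
     (\<forall>y. \<bar>y\<bar> \<le> 4 \<longrightarrow> (\<exists>p\<in>C. p $ 2 = y)) \<and>
     (\<forall>p\<in>C. \<bar>p $ 1\<bar> \<le> 43 / 10 \<and> \<bar>p $ 2\<bar> \<le> 4 \<and> (p $ 2 = 0 \<longrightarrow> \<bar>p $ 3\<bar> \<le> 8)) \<and>
     (\<forall>p\<in>C. \<forall>q\<in>C. \<bar>p $ 1 - q $ 1\<bar> \<le> \<bar>p $ 2 - q $ 2\<bar> / 3 \<and> \<bar>p $ 3 - q $ 3\<bar> \<le> 2 / 5 * \<bar>p $ 2 - q $ 2\<bar>)"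

lemma admissible_third:
  assumes "admissible C" "p \<in> C" shows "\<bar>p $ 3\<bar> \<le> 10"
proof -
  obtain z where z: "z \<in> C" "z $ 2 = 0" using assms(1) unfolding admissible_def by (metis abs_zero zero_le_numeral)
  have "\<bar>z $ 3\<bar> \<le> 8" "\<bar>p $ 3 - z $ 3\<bar> \<le> 2 / 5 * \<bar>p $ 2 - z $ 2\<bar>" "\<bar>p $ 2\<bar> \<le> 4"
    using assms z unfolding admissible_def by blast+
  then show ?thesis unfolding z(2) diff_zero by linarith
qed

lemma admissible_box: "admissible C \<Longrightarrow> p \<in> C \<Longrightarrow> p \<in> box3 5 5 500"
  using admissible_third[of C p] unfolding admissible_def box3_def by force

lemma admissible_strip: "admissible C \<Longrightarrow> p \<in> C \<Longrightarrow> side b p \<Longrightarrow> p \<in> strips"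
  using admissible_third[of C p] unfolding admissible_def strips_def side_def by (force split: if_splits)

lemma xi_mult_abs: "\<bar>\<xi> * t\<bar> \<le> 9 / 8 * \<bar>t\<bar>"
  using mult_right_mono[OF xi(2), of "\<bar>t\<bar>"] xi_pos by (simp add: abs_mult)

lemma admissible_image_expands:
  assumes g: "f_near g" and C: "admissible C" and p: "p \<in> C" "q \<in> C" and side: "side b p" "side b q"
  shows "\<bar>g p $ 1 - g q $ 1\<bar> \<le> \<bar>g p $ 2 - g q $ 2\<bar> / 3"
    and "\<bar>g p $ 3 - g q $ 3\<bar> \<le> 2 / 5 * \<bar>g p $ 2 - g q $ 2\<bar>"
    and "\<bar>g p $ 2 - g q $ 2\<bar> \<le> 10 * \<bar>p $ 2 - q $ 2\<bar>"
proof -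
  define x y z a where "x = p $ 1 - q $ 1" and "y = p $ 2 - q $ 2" and "z = p $ 3 - q $ 3" and "a = p $ 2 + q $ 2"
  have c: "\<bar>x\<bar> \<le> \<bar>y\<bar> / 3" "\<bar>z\<bar> \<le> 2 / 5 * \<bar>y\<bar>" and py: "\<bar>p $ 2\<bar> \<le> 4" "\<bar>q $ 2\<bar> \<le> 4"
    using C p unfolding admissible_def x_def y_def z_def by blast+
  have e: "(\<bar>x\<bar> + \<bar>y\<bar> + \<bar>z\<bar>) / 1000000 \<le> \<bar>y\<bar> / 500000" using c by simp
  note d = f_near_diff[OF g admissible_box[OF C p(1)] admissible_box[OF C p(2)],
      folded x_def y_def z_def a_def]
  have lo: "4 * \<bar>y\<bar> \<le> \<bar>a * y\<bar>" using mult_right_mono[OF side_sum[OF side], of "\<bar>y\<bar>"] by (simp add: abs_mult a_def)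
  have hi: "\<bar>a * y\<bar> \<le> 8 * \<bar>y\<bar>" using py by (auto simp: abs_mult a_def intro!: mult_right_mono)
  have xz: "\<bar>\<xi> * z\<bar> \<le> 9 / 8 * \<bar>z\<bar>" by (rule xi_mult_abs)
  show "\<bar>g p $ 1 - g q $ 1\<bar> \<le> \<bar>g p $ 2 - g q $ 2\<bar> / 3"
    and "\<bar>g p $ 3 - g q $ 3\<bar> \<le> 2 / 5 * \<bar>g p $ 2 - g q $ 2\<bar>"
    and "\<bar>g p $ 2 - g q $ 2\<bar> \<le> 10 * \<bar>p $ 2 - q $ 2\<bar>"
    using cone_arithmetic[OF d e c lo hi xz] unfolding y_def by blast+
qed

text \<open>The covering property. Both the right and the left branch of the image of an admissible set stretch across \<open>[- 4, 4]\<close>. At the crossing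
with \<open>y = 0\<close> the third coordinate becomes \<open>\<xi> z + y\<close> with \<open>2 \<le> |y| \<le> 4\<close>. Since it varies by at most \<open>2/5 |y|\<close> along the set, the sign of \<open>y\<close> can be chosen
such that the bound \<open>|z| \<le> 8\<close> at \<open>y = 0\<close> persists: \<open>(\<xi> - 1) 8 \<le> 1 < 1.1 = 2 (1 - 9/8 \<cdot> 2/5)\<close>.\<close>
lemma admissible_image:
  assumes g: "f_near g" and C: "admissible C"
  obtains b C' where "admissible C'" "C' \<subseteq> g ` {p \<in> C. side b p}"
proof -
  obtain z where z: "z \<in> C" "z $ 2 = 0" using C unfolding admissible_def by (metis abs_zero zero_le_numeral)
  then have z8: "\<bar>z $ 3\<bar> \<le> 8" using C unfolding admissible_def by blast
  \<comment> \<open>the branch on which \<open>y\<close> has the sign opposite to that of \<open>z\<close> at \<open>y = 0\<close>\<close>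
  define b where "b \<longleftrightarrow> z $ 3 < 0"
  define C' where "C' = {q \<in> g ` {p \<in> C. side b p}. \<bar>q $ 2\<bar> \<le> 4}"
  have "admissible C'" unfolding admissible_def
  proof (intro conjI allI impI ballI)
    fix p q assume "p \<in> C'" "q \<in> C'"
    then obtain p' q' where "p' \<in> C" "q' \<in> C" "side b p'" "side b q'" "p = g p'" "q = g q'"
      unfolding C'_def by auto
    with admissible_image_expands(1,2)[OF g C]
    show "\<bar>p $ 1 - q $ 1\<bar> \<le> \<bar>p $ 2 - q $ 2\<bar> / 3" "\<bar>p $ 3 - q $ 3\<bar> \<le> 2 / 5 * \<bar>p $ 2 - q $ 2\<bar>" by auto
  next
    fix q assume q: "q \<in> C'"
    then obtain p where p: "p \<in> C" "side b p" "q = g p" unfolding C'_def by auto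
    show "\<bar>q $ 2\<bar> \<le> 4" using q by (simp add: C'_def)
    have p2: "\<bar>p $ 2\<bar> \<le> 4" and pz: "\<bar>p $ 3 - z $ 3\<bar> \<le> 2 / 5 * \<bar>p $ 2\<bar>"
      using C p(1) z unfolding admissible_def by (blast, metis diff_zero)
    note n = f_near_nth[OF g admissible_box[OF C p(1)]]
    show "\<bar>q $ 1\<bar> \<le> 43 / 10" unfolding p(3) using n(1) p2 by linarith
    define A where "A = \<xi> * z $ 3"
    define B where "B = \<xi> * (p $ 3 - z $ 3)"
    have AB: "\<xi> * p $ 3 = A + B" by (simp add: A_def B_def algebra_simps)
    have B: "\<bar>B\<bar> \<le> 9 / 20 * \<bar>p $ 2\<bar>" unfolding B_def by (rule order.trans[OF xi_mult_abs]) (use pz in simp)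
    have A: "\<bar>A\<bar> \<le> 9" using xi_mult_abs[of "z $ 3"] z8 unfolding A_def by linarith
    have s: "\<bar>q $ 3 - (A + B + p $ 2)\<bar> \<le> 1 / 1000000" using n(3) unfolding p(3) AB .
    show "\<bar>q $ 3\<bar> \<le> 8"
    proof (cases b)
      case True
      then have "A \<le> 0" using xi_pos unfolding b_def A_def by (simp add: mult_le_0_iff)
      moreover have "2 \<le> p $ 2" using p(2) True by (simp add: side_def)
      ultimately show ?thesis using A B s p2 by linarith
    next
      case False
      then have "0 \<le> A" using xi_pos unfolding b_def A_def by simp
      moreover have "p $ 2 \<le> - 2" using p(2) False by (simp add: side_def)
      ultimately show ?thesis using A B s p2 by linarith
    qed
  next
    fix y :: real assume y: "\<bar>y\<bar> \<le> 4"
    obtain P where P: "\<And>y. \<bar>y\<bar> \<le> 4 \<Longrightarrow> P y \<in> C \<and> P y $ 2 = y"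
      using C unfolding admissible_def by metis
    define \<sigma> :: real where "\<sigma> = (if b then 1 else - 1)"
    have \<sigma>: "\<bar>\<sigma> * t\<bar> = \<bar>t\<bar>" for t unfolding \<sigma>_def by simp
    define h where "h t = g (P (\<sigma> * t)) $ 2" for t
    have Pt: "P (\<sigma> * t) \<in> C" "P (\<sigma> * t) $ 2 = \<sigma> * t" "side b (P (\<sigma> * t))" if "t \<in> {2..4}" for t
      using P[of "\<sigma> * t"] \<sigma>[of t] that by (auto simp: side_def \<sigma>_def)
    have "10-lipschitz_on {2..4} h"
    proof (rule lipschitz_onI)
      fix s t :: real assume st: "s \<in> {2..4}" "t \<in> {2..4}"
      have "\<bar>h s - h t\<bar> \<le> 10 * \<bar>\<sigma> * s - \<sigma> * t\<bar>"
        using admissible_image_expands(3)[OF g C Pt(1)[OF st(1)] Pt(1)[OF st(2)] Pt(3)[OF st(1)] Pt(3)[OF st(2)]]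
        unfolding h_def Pt(2)[OF st(1)] Pt(2)[OF st(2)] .
      then show "dist (h s) (h t) \<le> 10 * dist s t"
        using \<sigma>[of "s - t"] by (simp add: dist_real_def right_diff_distrib)
    qed simp
    then have cont: "continuous_on {2..4} h" by (rule lipschitz_on_continuous_on)
    have hb: "\<bar>h t - (t\<^sup>2 + 3 / 10 * P (\<sigma> * t) $ 1 - 19 / 2)\<bar> \<le> 1 / 1000000" "\<bar>P (\<sigma> * t) $ 1\<bar> \<le> 43 / 10" if "t \<in> {2..4}" for t
    proof -
      have "(\<sigma> * t)\<^sup>2 = t\<^sup>2" by (simp add: \<sigma>_def power_mult_distrib)
      then show "\<bar>h t - (t\<^sup>2 + 3 / 10 * P (\<sigma> * t) $ 1 - 19 / 2)\<bar> \<le> 1 / 1000000"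
        using f_near_nth(2)[OF g admissible_box[OF C Pt(1)[OF that]]] Pt(2)[OF that] unfolding h_def by simp
      show "\<bar>P (\<sigma> * t) $ 1\<bar> \<le> 43 / 10" using C Pt(1)[OF that] unfolding admissible_def by blast
    qed
    have "2 \<in> {2..4::real}" "4 \<in> {2..4::real}" by auto
    note hb2 = hb[OF this(1)] and hb4 = hb[OF this(2)]
    have "h 2 \<le> y" "y \<le> h 4" using hb2 hb4 y unfolding power2_eq_square by linarith+
    from IVT'[OF this _ cont] obtain t where t: "2 \<le> t" "t \<le> 4" "h t = y" by auto
    then show "\<exists>p\<in>C'. p $ 2 = y" using Pt[of t] y unfolding C'_def h_def
      by (intro bexI[of _ "g (P (\<sigma> * t))"]) auto
  qed
  then show ?thesis by (rule that) (auto simp: C'_def)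
qed

lemma admissible_finite_orbit:
  assumes g: "f_near g"
  shows "admissible C \<Longrightarrow> \<exists>q\<in>C. \<forall>j\<le>n. (g ^^ j) q \<in> strips"
proof (induction n arbitrary: C)
  case 0
  obtain b C' where "admissible C'" and C': "C' \<subseteq> g ` {p \<in> C. side b p}" using admissible_image[OF g 0] .
  then obtain q where "q \<in> C'" unfolding admissible_def by (metis abs_zero zero_le_numeral)
  then obtain p where "p \<in> C" "side b p" using C' by auto
  with admissible_strip[OF 0] show ?case by auto
next
  case (Suc n)
  obtain b C' where adm: "admissible C'" and C': "C' \<subseteq> g ` {p \<in> C. side b p}" using admissible_image[OF g Suc.prems] .
  obtain q where q: "q \<in> C'" "\<forall>j\<le>n. (g ^^ j) q \<in> strips" using Suc.IH[OF adm] by auto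
  then obtain p where p: "p \<in> C" "side b p" "q = g p" using C' by auto
  have "(g ^^ j) p \<in> strips" if "j \<le> Suc n" for j
  proof (cases j)
    case 0 then show ?thesis using admissible_strip[OF Suc.prems p(1,2)] by simp
  next
    case (Suc i)
    then show ?thesis using q(2) that p(3) by (simp add: funpow_swap1)
  qed
  with p(1) show ?case by blast
qed

lemma closed_strips: "closed strips"
proof -
  have eq: "strips = box3 (43 / 10) 4 10 \<inter> {p. 2 \<le> \<bar>p $ 2\<bar>}" unfolding strips_def box3_def by auto
  show ?thesis unfolding eq by (intro closed_Int compact_imp_closed[OF compact_box3] closed_abs_le_nth)
qed

text \<open>Every compact admissible set contains a point whose forward orbit stays in the strips. This is the blender property: such
points lie on a totally disconnected family of stable curves, yet a curve in the strong unstable cone cannot avoid them.\<close>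
lemma admissible_orbit:
  assumes g: "f_near g" "continuous_on UNIV g" and C: "admissible C" "compact C"
  obtains q where "q \<in> C" "\<And>j. (g ^^ j) q \<in> strips"
proof -
  have cont: "continuous_on UNIV (g ^^ j)" for j
  proof (induction j)
    case (Suc j)
    then show ?case using continuous_on_compose2[OF g(2)] by (simp add: o_def)
  qed (simp add: id_def)
  define A where "A n = C \<inter> (\<Inter>j\<in>{..n}. (g ^^ j) -` strips)" for n
  have "closed ((g ^^ j) -` strips)" for j using cont closed_strips by (rule closed_vimage[rotated])
  then have "compact (A n)" for n unfolding A_def by (intro compact_Int_closed C closed_INT) auto
  moreover have "A n \<noteq> {}" for n using admissible_finite_orbit[OF g(1) C(1), of n] unfolding A_def by auto
  moreover have "A n \<subseteq> A m" if "m \<le> n" for m n using that unfolding A_def by auto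
  ultimately have "\<Inter>(range A) \<noteq> {}" by (rule compact_nest)
  then obtain q where "\<And>n. q \<in> A n" by auto
  then show ?thesis by (intro that[of q]) (auto simp: A_def)
qed

end

section \<open>The reference disk\<close>

lemma cone_arithmetic_reference:
  fixes x y z ay xz :: real
  assumes "\<bar>x\<bar> \<le> 3 / 10 * y" "\<bar>z\<bar> \<le> 39 / 100 * y" "4 * y \<le> ay" "\<bar>xz\<bar> \<le> 9 / 8 * \<bar>z\<bar>"
  defines "d \<equiv> ay + 3 / 10 * x"
  shows "\<bar>y\<bar> \<le> 3 / 10 * d" "\<bar>xz + y\<bar> \<le> 39 / 100 * d" "y \<le> d"
proof -
  have y: "0 \<le> y" using assms(1) by linarith
  have 1: "391 / 100 * y \<le> d" using assms(1,3) unfolding d_def by linarith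
  show "\<bar>y\<bar> \<le> 3 / 10 * d" using 1 y by linarith
  have "\<bar>xz + y\<bar> \<le> 3 / 2 * y" using assms(2,4) y by linarith
  then show "\<bar>xz + y\<bar> \<le> 39 / 100 * d" using 1 y by linarith
  show "y \<le> d" using 1 y by linarith
qed

lemma cone_arithmetic_perturbed:
  fixes g1 g2 g3 s1 s2 s3 m :: real
  assumes "\<bar>g1 - s1\<bar> \<le> m / 1000" "\<bar>g2 - s2\<bar> \<le> m / 1000" "\<bar>g3 - s3\<bar> \<le> m / 1000"
    and "m \<le> \<bar>g2\<bar>" "\<bar>g1\<bar> \<le> 3 / 10 * \<bar>g2\<bar>" "\<bar>g3\<bar> \<le> 39 / 100 * \<bar>g2\<bar>"
  shows "\<bar>s1\<bar> \<le> \<bar>s2\<bar> / 3" "\<bar>s3\<bar> \<le> 2 / 5 * \<bar>s2\<bar>"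
proof -
  have 2: "999 / 1000 * \<bar>g2\<bar> \<le> \<bar>s2\<bar>" using assms(2,4) by linarith
  have "\<bar>s1\<bar> \<le> 301 / 1000 * \<bar>g2\<bar>" "\<bar>s3\<bar> \<le> 391 / 1000 * \<bar>g2\<bar>" using assms(1,3,4,5,6) by linarith+
  with 2 show "\<bar>s1\<bar> \<le> \<bar>s2\<bar> / 3" "\<bar>s3\<bar> \<le> 2 / 5 * \<bar>s2\<bar>" by linarith+
qed

context henon
begin

lemma funpow_f_shift: "(f ^^ n) (p + vector [0, 0, c]) = (f ^^ n) p + vector [0, 0, \<xi> ^ n * c]"
proof (induction n)
  case (Suc n)
  then show ?case by (auto intro!: vector3_eqI simp: vector_3 algebra_simps)
qed simp

lemma continuous_funpow_f: "continuous_on UNIV (f ^^ n)"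
  using continuous_orb[of "int n"] by (simp add: orb_nat)

lemma continuous_on_line: "continuous_on X (\<lambda>s. (f ^^ n) (vector [0, s, 0]) $ i)"
proof -
  have eq: "vector [0, s, 0] = s *\<^sub>R (axis 2 1 :: real ^ 3)" for s :: real
    by (rule vector3_eqI) (simp_all add: vector_3 axis_def)
  have "continuous_on X (\<lambda>s. (f ^^ n) (s *\<^sub>R axis 2 1))"
    by (rule continuous_on_compose2[OF continuous_funpow_f]) (auto intro!: continuous_intros)
  then show ?thesis unfolding eq by (rule continuous_on_component)
qed

text \<open>A piece of the line \<open>x = z = 0\<close> that stays on the right side for \<open>N\<close> steps and is then stretched across \<open>[- 4.2, 4.2]\<close>.\<close>
lemma stretched_segment:
  "\<exists>a b. a < b \<and> (f ^^ N) (vector [0, a, 0]) $ 2 = - (21 / 5) \<and> (f ^^ N) (vector [0, b, 0]) $ 2 = 21 / 5 \<and>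
    (\<forall>s\<in>{a..b}. \<forall>t\<in>{a..b}. s \<le> t \<longrightarrow>
      (let d = (f ^^ N) (vector [0, t, 0]) - (f ^^ N) (vector [0, s, 0]) in
        t - s \<le> d $ 2 \<and> \<bar>d $ 1\<bar> \<le> 3 / 10 * d $ 2 \<and> \<bar>d $ 3\<bar> \<le> 39 / 100 * d $ 2)) \<and>
    (\<forall>s\<in>{a..b}. \<bar>(f ^^ N) (vector [0, s, 0]) $ 1\<bar> \<le> 21 / 5 \<and> (\<forall>i<N. 2 \<le> (f ^^ i) (vector [0, s, 0]) $ 2))"
proof (induction N)
  case 0
  show ?case by (rule exI[of _ "- (21 / 5)"], rule exI[of _ "21 / 5"]) (auto simp: vector_3 Let_def)
next
  case (Suc N)
  define F where "F n s = (f ^^ n) (vector [0, s, 0])" for n s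
  obtain a b where ab: "a < b" and Fa: "F N a $ 2 = - (21 / 5)" and Fb: "F N b $ 2 = 21 / 5"
    and cone: "\<And>s t. s \<in> {a..b} \<Longrightarrow> t \<in> {a..b} \<Longrightarrow> s \<le> t \<Longrightarrow> t - s \<le> F N t $ 2 - F N s $ 2 \<and>
        \<bar>F N t $ 1 - F N s $ 1\<bar> \<le> 3 / 10 * (F N t $ 2 - F N s $ 2) \<and> \<bar>F N t $ 3 - F N s $ 3\<bar> \<le> 39 / 100 * (F N t $ 2 - F N s $ 2)"
    and bd: "\<And>s. s \<in> {a..b} \<Longrightarrow> \<bar>F N s $ 1\<bar> \<le> 21 / 5" "\<And>s i. s \<in> {a..b} \<Longrightarrow> i < N \<Longrightarrow> 2 \<le> F i s $ 2"
    using Suc.IH by (auto simp: F_def Let_def)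
  have FS: "F (Suc N) s = f (F N s)" for s by (simp add: F_def)
  have cont: "continuous_on X (\<lambda>s. F n s $ 2)" for n X
    unfolding F_def by (rule continuous_on_line)
  \<comment> \<open>only the part with \<open>y \<ge> 2\<close> is kept; its image reaches beyond \<open>[- 4.2, 4.2]\<close> on both ends\<close>
  obtain c where c: "a \<le> c" "c \<le> b" "F N c $ 2 = 2"
    using IVT'[of "\<lambda>s. F N s $ 2" a 2 b] cont Fa Fb ab by auto
  have "F (Suc N) c $ 2 \<le> - (21 / 5)" using bd(1)[of c] c by (simp add: FS)
  moreover have Sb: "21 / 5 \<le> F (Suc N) b $ 2" using bd(1)[of b] ab by (simp add: FS Fb power2_eq_square abs_le_iff)
  ultimately obtain a' where a': "c \<le> a'" "a' \<le> b" "F (Suc N) a' $ 2 = - (21 / 5)"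
    using IVT'[of "\<lambda>s. F (Suc N) s $ 2" c "- (21 / 5)" b] cont c by auto
  obtain b' where b': "a' \<le> b'" "b' \<le> b" "F (Suc N) b' $ 2 = 21 / 5"
    using IVT'[of "\<lambda>s. F (Suc N) s $ 2" a' "21 / 5" b] cont a' Sb by auto
  have sub: "s \<in> {a..b}" if "s \<in> {a'..b'}" for s using that a' b' c by auto
  have y2: "2 \<le> F N s $ 2" if "s \<in> {a'..b'}" for s
    using cone[of c s] c sub[OF that] that a' by auto
  show ?case unfolding F_def[symmetric]
  proof (rule exI[of _ a'], rule exI[of _ b'], intro conjI ballI allI impI)
    show "a' < b'" using a' b' by (cases "a' = b'") auto
    fix s assume s: "s \<in> {a'..b'}"
    have "F N s $ 2 \<le> 21 / 5" using cone[of s b] sub[OF s] Fb ab by auto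
    then show "\<bar>F (Suc N) s $ 1\<bar> \<le> 21 / 5" using y2[OF s] by (simp add: FS)
    show "2 \<le> F i s $ 2" if "i < Suc N" for i
      using bd(2)[OF sub[OF s], of i] y2[OF s] that by (cases "i = N") auto
    fix t assume t: "t \<in> {a'..b'}" and st: "s \<le> t"
    define x y z A where "x = F N t $ 1 - F N s $ 1" and "y = F N t $ 2 - F N s $ 2" and "z = F N t $ 3 - F N s $ 3"
      and "A = F N t $ 2 + F N s $ 2"
    have h: "t - s \<le> y" "\<bar>x\<bar> \<le> 3 / 10 * y" "\<bar>z\<bar> \<le> 39 / 100 * y"
      using cone[OF sub[OF s] sub[OF t] st] unfolding x_def y_def z_def by auto
    have Ay: "4 * y \<le> A * y" using y2[OF s] y2[OF t] h(1) st unfolding A_def by (intro mult_right_mono) auto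
    have d: "F (Suc N) t $ 1 - F (Suc N) s $ 1 = y" "F (Suc N) t $ 2 - F (Suc N) s $ 2 = A * y + 3 / 10 * x"
       "F (Suc N) t $ 3 - F (Suc N) s $ 3 = \<xi> * z + y"
      unfolding FS f_nth x_def y_def z_def A_def by (simp_all add: field_simps power2_eq_square)
    show "let d = F (Suc N) t - F (Suc N) s in
        t - s \<le> d $ 2 \<and> \<bar>d $ 1\<bar> \<le> 3 / 10 * d $ 2 \<and> \<bar>d $ 3\<bar> \<le> 39 / 100 * d $ 2"
      unfolding Let_def vector_minus_component d
      using cone_arithmetic_reference[OF h(2,3) Ay xi_mult_abs] h(1) by auto
  qed (use a' b' in auto)
qed

text \<open>The reference disk. Translating the segment along \<open>z\<close> commutes with the iteration up to the factor \<open>\<xi>\<^sup>N\<close>, which allows the image to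
be moved to \<open>z = 0\<close> over \<open>y = 0\<close>. The parametrisation is the \<open>N\<close>-th iterate of an affine map, so smoothness
is inherited.\<close>
lemma reference_curve:
  obtains r :: real and \<gamma> :: "real \<Rightarrow> real ^ 3" and w :: "real \<Rightarrow> real ^ 3"
  where "0 < r" "\<gamma> \<in> disk_embeddings" "\<gamma> (- 1) $ 2 = - (21 / 5)" "\<gamma> 1 $ 2 = 21 / 5"
    "\<And>s t. s \<in> {-1..1} \<Longrightarrow> t \<in> {-1..1} \<Longrightarrow> r * \<bar>t - s\<bar> \<le> \<bar>\<gamma> t $ 2 - \<gamma> s $ 2\<bar> \<and>
        \<bar>\<gamma> t $ 1 - \<gamma> s $ 1\<bar> \<le> 3 / 10 * \<bar>\<gamma> t $ 2 - \<gamma> s $ 2\<bar> \<and> \<bar>\<gamma> t $ 3 - \<gamma> s $ 3\<bar> \<le> 39 / 100 * \<bar>\<gamma> t $ 2 - \<gamma> s $ 2\<bar>"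
    "\<And>t. t \<in> {-1..1} \<Longrightarrow> \<bar>\<gamma> t $ 1\<bar> \<le> 21 / 5"
    "\<And>t. t \<in> {-1..1} \<Longrightarrow> \<gamma> t $ 2 = 0 \<Longrightarrow> \<gamma> t $ 3 = 0"
    "\<And>t. \<gamma> t = (f ^^ N) (w t)" "\<And>t. w t $ 1 = 0"
    "\<And>t i. t \<in> {-1..1} \<Longrightarrow> i < N \<Longrightarrow> 2 \<le> (f ^^ i) (w t) $ 2"
proof -
  define F where "F n s = (f ^^ n) (vector [0, s, 0])" for n s
  obtain a b where ab: "a < b" and Fa: "F N a $ 2 = - (21 / 5)" and Fb: "F N b $ 2 = 21 / 5"
    and cone: "\<And>s t. s \<in> {a..b} \<Longrightarrow> t \<in> {a..b} \<Longrightarrow> s \<le> t \<Longrightarrow> t - s \<le> F N t $ 2 - F N s $ 2 \<and>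
        \<bar>F N t $ 1 - F N s $ 1\<bar> \<le> 3 / 10 * (F N t $ 2 - F N s $ 2) \<and> \<bar>F N t $ 3 - F N s $ 3\<bar> \<le> 39 / 100 * (F N t $ 2 - F N s $ 2)"
    and bd: "\<And>s. s \<in> {a..b} \<Longrightarrow> \<bar>F N s $ 1\<bar> \<le> 21 / 5" "\<And>s i. s \<in> {a..b} \<Longrightarrow> i < N \<Longrightarrow> 2 \<le> F i s $ 2"
    using stretched_segment[of N] by (auto simp: F_def Let_def)
  define r where "r = (b - a) / 2"
  define l where "l t = (a + b) / 2 + r * t" for t
  have r: "0 < r" using ab by (simp add: r_def)
  have l: "l t \<in> {a..b}" if "t \<in> {-1..1}" for t
  proof -
    have "- r \<le> r * t" "r * t \<le> r" using mult_left_mono[of "- 1" t r] mult_left_mono[of t 1 r] that r by auto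
    then show ?thesis unfolding l_def r_def by (simp add: field_simps)
  qed
  have l1: "l (- 1) = a" "l 1 = b" by (simp_all add: l_def r_def field_simps)
  have cone_abs: "\<bar>s - t\<bar> \<le> \<bar>F N t $ 2 - F N s $ 2\<bar> \<and>
        \<bar>F N t $ 1 - F N s $ 1\<bar> \<le> 3 / 10 * \<bar>F N t $ 2 - F N s $ 2\<bar> \<and> \<bar>F N t $ 3 - F N s $ 3\<bar> \<le> 39 / 100 * \<bar>F N t $ 2 - F N s $ 2\<bar>"
    if "s \<in> {a..b}" "t \<in> {a..b}" for s t
  proof (cases "s \<le> t")
    case True
    then have "\<bar>F N t $ 2 - F N s $ 2\<bar> = F N t $ 2 - F N s $ 2" using cone[OF that] by auto
    then show ?thesis using cone[OF that] True by simp
  next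
    case False
    then have "\<bar>F N t $ 2 - F N s $ 2\<bar> = F N s $ 2 - F N t $ 2" using cone[OF that(2,1)] by auto
    then show ?thesis using cone[OF that(2,1)] False by (simp add: abs_minus_commute)
  qed
  obtain c0 where c0: "c0 \<in> {a..b}" "F N c0 $ 2 = 0"
  proof -
    have "continuous_on {a..b} (\<lambda>s. F N s $ 2)" unfolding F_def by (rule continuous_on_line)
    then show ?thesis using IVT'[of "\<lambda>s. F N s $ 2" a 0 b] Fa Fb ab that by auto
  qed
  \<comment> \<open>the translation that moves the crossing with \<open>y = 0\<close> to \<open>z = 0\<close>\<close>
  define c where "c = - F N c0 $ 3 / \<xi> ^ N"
  define w :: "real \<Rightarrow> real ^ 3" where "w t = vector [0, l t, c]" for t
  define \<gamma> where "\<gamma> t = (f ^^ N) (w t)" for t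
  have w: "w t = vector [0, l t, 0] + vector [0, 0, c]" for t
    by (rule vector3_eqI) (simp_all add: w_def vector_3)
  have fw: "(f ^^ i) (w t) = F i (l t) + vector [0, 0, \<xi> ^ i * c]" for i t
    unfolding w funpow_f_shift F_def ..
  have \<gamma>: "\<gamma> t $ 1 = F N (l t) $ 1" "\<gamma> t $ 2 = F N (l t) $ 2" "\<gamma> t $ 3 = F N (l t) $ 3 - F N c0 $ 3" for t
    using xi_pos unfolding \<gamma>_def fw by (simp_all add: vector_3 c_def)
  have l_diff: "r * \<bar>t - s\<bar> = \<bar>l s - l t\<bar>" for s t
  proof -
    have "l s - l t = r * (s - t)" by (simp add: l_def algebra_simps)
    then show ?thesis using r by (simp add: abs_mult abs_minus_commute)
  qed
  have cone\<gamma>: "r * \<bar>t - s\<bar> \<le> \<bar>\<gamma> t $ 2 - \<gamma> s $ 2\<bar> \<and>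
        \<bar>\<gamma> t $ 1 - \<gamma> s $ 1\<bar> \<le> 3 / 10 * \<bar>\<gamma> t $ 2 - \<gamma> s $ 2\<bar> \<and> \<bar>\<gamma> t $ 3 - \<gamma> s $ 3\<bar> \<le> 39 / 100 * \<bar>\<gamma> t $ 2 - \<gamma> s $ 2\<bar>"
    if "s \<in> {-1..1}" "t \<in> {-1..1}" for s t
    using cone_abs[OF l l, OF that] by (simp add: \<gamma> l_diff)
  have emb: "\<gamma> \<in> disk_embeddings"
  proof -
    have waff: "w = (\<lambda>t. vector [0, (a + b) / 2, c] + t *\<^sub>R (r *\<^sub>R axis 2 1))"
      by (rule ext, rule vector3_eqI) (simp_all add: w_def l_def vector_3 axis_def)
    define L :: "real \<Rightarrow>\<^sub>L (real ^ 3)" where "L = blinfun_scaleR_left (r *\<^sub>R axis 2 1)"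
    have "(w has_derivative blinfun_apply L) (at t within S)" for t S
      unfolding waff L_def blinfun_scaleR_left.rep_eq
      by (rule has_derivative_eq_rhs, (rule derivative_intros)+) simp
    then have "C1_on (cball 0 1) w" unfolding C1_on_def by (intro exI[of _ "\<lambda>_. L"]) auto
    moreover have "\<gamma> = (\<lambda>t. (f ^^ N) (w t))" by (rule ext) (rule \<gamma>_def)
    ultimately have C1: "C1_on (cball 0 1) \<gamma>" by (simp only:) (rule C1_on_compose[OF C1_on_funpow[OF C1_f]])
    have ball: "cball 0 1 = {-1..1::real}" by (simp add: cball_eq_atLeastAtMost)
    have expand: "r * \<bar>s - t\<bar> \<le> norm (\<gamma> s - \<gamma> t)" if "s \<in> {-1..1}" "t \<in> {-1..1}" for s t
      using cone\<gamma>[OF that(2,1)] component_le_norm_cart[of "\<gamma> s - \<gamma> t" 2] by simp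
    have "inj_on \<gamma> {-1..1}"
    proof (rule inj_onI)
      fix s t :: real assume "s \<in> {-1..1}" "t \<in> {-1..1}" "\<gamma> s = \<gamma> t"
      then have "r * \<bar>s - t\<bar> \<le> 0" using expand[of s t] by simp
      then show "s = t" using r by (simp add: mult_le_0_iff)
    qed
    moreover have "inj (frechet_derivative \<gamma> (at x within {-1..1}))" if "x \<in> {-1..1}" for x
      by (rule inj_derivative_within[OF _ that _ r expand])
        (use C1_on_has_derivative[OF C1[unfolded ball] that] in auto)
    ultimately show ?thesis using C1 unfolding disk_embeddings_def ball by auto
  qed
  show ?thesis
  proof (rule that[OF r emb _ _ cone\<gamma>])
    show "\<gamma> (- 1) $ 2 = - (21 / 5)" "\<gamma> 1 $ 2 = 21 / 5" by (simp_all add: \<gamma> l1 Fa Fb)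
    show "\<bar>\<gamma> t $ 1\<bar> \<le> 21 / 5" if "t \<in> {-1..1}" for t using bd(1)[OF l[OF that]] by (simp add: \<gamma>)
    show "\<gamma> t $ 3 = 0" if "t \<in> {-1..1}" "\<gamma> t $ 2 = 0" for t
    proof -
      have "F N (l t) $ 2 = 0" using that(2) by (simp only: \<gamma>)
      then have "\<bar>F N (l t) $ 3 - F N c0 $ 3\<bar> \<le> 39 / 100 * \<bar>0 - 0\<bar>"
        using cone_abs[OF c0(1) l[OF that(1)]] c0(2) by (simp only:)
      then show ?thesis by (simp add: \<gamma>)
    qed
    show "\<gamma> t = (f ^^ N) (w t)" "w t $ 1 = 0" for t by (simp_all add: \<gamma>_def w_def vector_3)
    show "2 \<le> (f ^^ i) (w t) $ 2" if "t \<in> {-1..1}" "i < N" for t i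
      unfolding fw using bd(2)[OF l[OF that(1)] that(2)] by (simp add: vector_3)
  qed
qed

text \<open>Curves that are \<open>C\<^sup>1\<close>-close to the reference disk contain an admissible set.\<close>
lemma admissible_perturbed_curve:
  fixes \<gamma> S :: "real \<Rightarrow> real ^ 3"
  assumes r: "0 < r"
    and ends: "\<gamma> (- 1) $ 2 = - (21 / 5)" "\<gamma> 1 $ 2 = 21 / 5"
    and cone: "\<And>s t. s \<in> {-1..1} \<Longrightarrow> t \<in> {-1..1} \<Longrightarrow> r * \<bar>t - s\<bar> \<le> \<bar>\<gamma> t $ 2 - \<gamma> s $ 2\<bar> \<and>
        \<bar>\<gamma> t $ 1 - \<gamma> s $ 1\<bar> \<le> 3 / 10 * \<bar>\<gamma> t $ 2 - \<gamma> s $ 2\<bar> \<and> \<bar>\<gamma> t $ 3 - \<gamma> s $ 3\<bar> \<le> 39 / 100 * \<bar>\<gamma> t $ 2 - \<gamma> s $ 2\<bar>"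
    and x: "\<And>t. t \<in> {-1..1} \<Longrightarrow> \<bar>\<gamma> t $ 1\<bar> \<le> 21 / 5"
    and z: "\<And>t. t \<in> {-1..1} \<Longrightarrow> \<gamma> t $ 2 = 0 \<Longrightarrow> \<gamma> t $ 3 = 0"
    and cont: "continuous_on {-1..1} \<gamma>" "continuous_on {-1..1} S"
    and close: "\<And>t. t \<in> {-1..1} \<Longrightarrow> norm (\<gamma> t - S t) \<le> 1 / 10"
    and lip: "\<And>s t. s \<in> {-1..1} \<Longrightarrow> t \<in> {-1..1} \<Longrightarrow> norm ((\<gamma> s - S s) - (\<gamma> t - S t)) \<le> r / 1000 * \<bar>s - t\<bar>"
  shows "admissible {p \<in> S ` {-1..1}. \<bar>p $ 2\<bar> \<le> 4}"
proof -
  have near: "\<bar>\<gamma> t $ i - S t $ i\<bar> \<le> 1 / 10" if "t \<in> {-1..1}" for t i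
    using component_le_norm_cart[of "\<gamma> t - S t" i] close[OF that] by simp
  obtain t0 where t0: "t0 \<in> {-1..1}" "\<gamma> t0 $ 2 = 0"
    using IVT'[of "\<lambda>s. \<gamma> s $ 2" "- 1" 0 1] ends continuous_on_component[OF cont(1)] by auto
  show ?thesis unfolding admissible_def
  proof (intro conjI allI impI ballI)
    fix y :: real assume y: "\<bar>y\<bar> \<le> 4"
    have "\<bar>\<gamma> (- 1) $ 2 - S (- 1) $ 2\<bar> \<le> 1 / 10" "\<bar>\<gamma> 1 $ 2 - S 1 $ 2\<bar> \<le> 1 / 10" by (rule near; simp)+
    then have "S (- 1) $ 2 \<le> y" "y \<le> S 1 $ 2" using ends y by linarith+
    then obtain t where "t \<in> {-1..1}" "S t $ 2 = y"
      using IVT'[of "\<lambda>s. S s $ 2" "- 1" y 1] continuous_on_component[OF cont(2)] by auto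
    with y show "\<exists>p\<in>{p \<in> S ` {- 1..1}. \<bar>p $ 2\<bar> \<le> 4}. p $ 2 = y" by auto
  next
    fix p assume "p \<in> {p \<in> S ` {-1..1}. \<bar>p $ 2\<bar> \<le> 4}"
    then obtain t where t: "t \<in> {-1..1}" "p = S t" "\<bar>p $ 2\<bar> \<le> 4" by auto
    show "\<bar>p $ 2\<bar> \<le> 4" by (rule t)
    show "\<bar>p $ 1\<bar> \<le> 43 / 10" using x[OF t(1)] near[OF t(1), of 1] unfolding t(2) by linarith
    assume 0: "p $ 2 = 0"
    have "\<gamma> t0 $ 3 = 0" using z t0 by auto
    then have "\<bar>\<gamma> t $ 3\<bar> \<le> 39 / 100 * \<bar>\<gamma> t $ 2\<bar>" using cone[OF t0(1) t(1)] t0(2) by simp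
    then show "\<bar>p $ 3\<bar> \<le> 8" using near[OF t(1), of 2] near[OF t(1), of 3] 0 unfolding t(2) by linarith
  next
    fix p q assume "p \<in> {p \<in> S ` {-1..1}. \<bar>p $ 2\<bar> \<le> 4}" "q \<in> {p \<in> S ` {-1..1}. \<bar>p $ 2\<bar> \<le> 4}"
    then obtain t s where t: "t \<in> {-1..1}" "p = S t" and s: "s \<in> {-1..1}" "q = S s" by auto
    have n: "\<bar>(\<gamma> t $ i - \<gamma> s $ i) - (S t $ i - S s $ i)\<bar> \<le> r * \<bar>t - s\<bar> / 1000" for i
      using order.trans[OF component_le_norm_cart[of "(\<gamma> t - S t) - (\<gamma> s - S s)" i] lip[OF t(1) s(1)]]
      by (simp add: algebra_simps)
    have c: "r * \<bar>t - s\<bar> \<le> \<bar>\<gamma> t $ 2 - \<gamma> s $ 2\<bar>" "\<bar>\<gamma> t $ 1 - \<gamma> s $ 1\<bar> \<le> 3 / 10 * \<bar>\<gamma> t $ 2 - \<gamma> s $ 2\<bar>"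
      "\<bar>\<gamma> t $ 3 - \<gamma> s $ 3\<bar> \<le> 39 / 100 * \<bar>\<gamma> t $ 2 - \<gamma> s $ 2\<bar>"
      using cone[OF s(1) t(1)] by blast+
    show "\<bar>p $ 1 - q $ 1\<bar> \<le> \<bar>p $ 2 - q $ 2\<bar> / 3" "\<bar>p $ 3 - q $ 3\<bar> \<le> 2 / 5 * \<bar>p $ 2 - q $ 2\<bar>"
      unfolding t(2) s(2) by (rule cone_arithmetic_perturbed[OF n n n c])+
  qed
qed

text \<open>The points of the reference disk shadow, in the past, the points of the horseshoe that were on the right side at all negative times.
Hence both lie close to the same unstable leaf, on which \<open>x\<close> is a function of \<open>y\<close> with Lipschitz constant 1/2.\<close>
lemma same_past_close:
  assumes w: "w $ 1 = 0" "\<And>i. i < N \<Longrightarrow> 2 \<le> (f ^^ i) w $ 2"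
    and p: "p \<in> \<Lambda>" "\<And>j. j < 0 \<Longrightarrow> 0 < orb p j $ 2"
  shows "\<bar>(f ^^ N) w $ 1 - p $ 1\<bar> \<le> 4 / 6 ^ N + \<bar>(f ^^ N) w $ 2 - p $ 2\<bar> / 2"
proof (cases "\<bar>(f ^^ N) w $ 2 - p $ 2\<bar> \<le> 2 * \<bar>(f ^^ N) w $ 1 - p $ 1\<bar>")
  case True
  define P where "P n = (f ^^ (N - n)) w" for n
  define Q where "Q n = orb p (- int n)" for n
  define x y a where "x n = P n $ 1 - Q n $ 1" and "y n = P n $ 2 - Q n $ 2" and "a n = P (Suc n) $ 2 + Q (Suc n) $ 2" for n
  have P: "P n = f (P (Suc n))" if "n < N" for n
  proof -
    have "N - n = Suc (N - Suc n)" using that by simp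
    then show ?thesis unfolding P_def by (simp del: diff_Suc_Suc)
  qed
  have Q: "Q n = f (Q (Suc n))" for n using orb_add1[of p "- int (Suc n)"] by (simp add: Q_def)
  have "6 ^ N * \<bar>x 0\<bar> \<le> \<bar>x N\<bar> \<and> \<bar>y N\<bar> \<le> 2 * \<bar>x N\<bar>"
  proof (rule backward_growth[of N a])
    fix n assume n: "n < N"
    have "2 \<le> P (Suc n) $ 2" using w(2)[of "N - Suc n"] n by (simp add: P_def)
    moreover have "2 \<le> Q (Suc n) $ 2"
      using p(2)[of "- int (Suc n)"] \<Lambda>_orb_Box[OF p(1), of "- int (Suc n)"] by (auto simp: Q_def Box_def)
    ultimately show "4 \<le> \<bar>a n\<bar>" unfolding a_def by linarith
    show "x n = y (Suc n)" unfolding x_def y_def P[OF n] Q[of n] by simp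
    show "y n = a n * y (Suc n) + 3 / 10 * x (Suc n)"
      unfolding x_def y_def a_def P[OF n] Q[of n] f_nth by (simp add: field_simps power2_eq_square)
  qed (use True in \<open>simp_all add: x_def y_def P_def Q_def\<close>)
  moreover have "\<bar>x N\<bar> \<le> 4" using \<Lambda>_orb_Box[OF p(1), of "- int N"] w(1) by (simp add: x_def P_def Q_def Box_def)
  ultimately have "6 ^ N * \<bar>x 0\<bar> \<le> 4" by linarith
  then have "\<bar>x 0\<bar> \<le> 4 / 6 ^ N" by (simp add: pos_le_divide_eq mult.commute)
  then have "\<bar>(f ^^ N) w $ 1 - p $ 1\<bar> \<le> 4 / 6 ^ N" by (simp add: x_def P_def Q_def)
  then show ?thesis by (rule order.trans) simp
next
  case False
  then have "\<bar>(f ^^ N) w $ 1 - p $ 1\<bar> \<le> \<bar>(f ^^ N) w $ 2 - p $ 2\<bar> / 2" by simp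
  then show ?thesis by (rule order.trans) simp
qed

end

section \<open>The blender\<close>

context henon
begin

lemma C1_close_f_near:
  assumes "g \<in> diffeos" "e < 1 / 1000000" "C1_close UNIV (box3 5 5 500) e f g"
  shows "f_near g"
  unfolding f_near_def
proof (intro ballI conjI)
  have C1: "C1_on UNIV g" using assms(1) by (simp add: diffeos_def)
  fix u assume u: "u \<in> box3 5 5 500"
  then show "norm (f u - g u) \<le> 1 / 1000000" using assms(2,3) unfolding C1_close_def by force
  fix v assume v: "v \<in> box3 5 5 500"
  have "norm ((f u - g u) - (f v - g v)) \<le> e * norm (u - v)"
    by (rule C1_close_lipschitz[OF assms(3) convex_box3 subset_UNIV C1_f C1 u v])
  also have "\<dots> \<le> 1 / 1000000 * norm (u - v)" using assms(2) by (intro mult_right_mono) auto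
  finally show "norm ((f u - g u) - (f v - g v)) \<le> norm (u - v) / 1000000" by simp
qed

lemma conjugacy_orbit:
  assumes "\<And>x. x \<in> \<Lambda> \<Longrightarrow> h (f x) = g (h x)" "x \<in> \<Lambda>"
  shows "h ((f ^^ n) x) = (g ^^ n) (h x)"
proof (induction n)
  case (Suc n)
  have "(f ^^ n) x \<in> \<Lambda>" using orb_in_\<Lambda>[OF assms(2), of "int n"] by (simp add: orb_nat)
  with assms(1) Suc show ?case by simp
qed simp

text \<open>A vector \<open>d\<close> in the stable cone that is \<open>s\<close>-close to a vector \<open>e\<close> in the unstable cone, up to \<open>m\<close>, is small: the two cones are transverse.\<close>
lemma small_cone_arithmetic:
  fixes dx dy ex ey s m :: real
  assumes "\<bar>dy\<bar> \<le> \<bar>dx\<bar> / 2" "\<bar>dx - ex\<bar> \<le> s" "\<bar>dy - ey\<bar> \<le> s" "\<bar>ex\<bar> \<le> m + \<bar>ey\<bar> / 2" "0 \<le> m"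
  shows "\<bar>dx\<bar> \<le> 2 * m + 2 * s"
proof -
  have "\<bar>ey\<bar> \<le> \<bar>dx\<bar> / 2 + s" "\<bar>dx\<bar> \<le> \<bar>ex\<bar> + s" using assms(1,2,3) by linarith+
  with assms(4,5) show ?thesis by linarith
qed

text \<open>The point \<open>q\<close> on the disk has a forward orbit in the strips. The point \<open>x\<close> of the horseshoe has the same future as \<open>q\<close> and the constant past
of the reference disk. The orbit of its continuation \<open>h x\<close> is asymptotic to that of \<open>q\<close>, and since the two pasts agree,
the distance of \<open>q\<close> from \<open>h x\<close> is so small that the whole forward orbit of \<open>q\<close> stays in \<open>V\<close>.\<close>
lemma blender_intersection:
  assumes g: "f_near g" "continuous_on UNIV g"
    and h: "\<And>x. x \<in> \<Lambda> \<Longrightarrow> h (f x) = g (h x)" "\<And>x. x \<in> \<Lambda> \<Longrightarrow> dist (h x) x < \<delta>" and \<delta>: "\<delta> \<le> 1 / 20"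
    and C: "admissible C" "compact C"
    and near: "\<And>q. q \<in> C \<Longrightarrow> \<exists>v. v $ 1 = 0 \<and> (\<forall>i<N. 2 \<le> (f ^^ i) v $ 2) \<and> dist q ((f ^^ N) v) \<le> \<eta>"
    and small: "102 * (8 / 6 ^ N + 2 * (\<eta> + \<delta>)) + \<delta> \<le> \<rho>"
    and V: "\<And>x y. x \<in> \<Lambda> \<Longrightarrow> dist x y < \<rho> \<Longrightarrow> y \<in> V"
  shows "C \<inter> W_s_loc g V (h ` \<Lambda>) \<noteq> {}"
proof -
  obtain q where q: "q \<in> C" "\<And>j. (g ^^ j) q \<in> strips" by (rule admissible_orbit[OF g C]) (rule that)
  \<comment> \<open>the symbol \<open>True\<close> at negative times is the past of the reference disk\<close>
  obtain x where x: "x \<in> \<Lambda>" and xs: "\<And>j. 0 < orb x j $ 2 \<longleftrightarrow> (j < 0 \<or> 0 < (g ^^ nat j) q $ 2)"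
    by (rule itinerary_exists) (rule that)
  have xn: "(f ^^ n) x \<in> \<Lambda>" for n using orb_in_\<Lambda>[OF x, of "int n"] by (simp add: orb_nat)
  define P where "P n = (g ^^ n) (h x)" for n
  define Q where "Q n = (g ^^ n) q" for n
  have Ph: "P n = h ((f ^^ n) x)" for n unfolding P_def using conjugacy_orbit[of h g x n, OF h(1) x] by simp
  have Pd: "norm (P n - (f ^^ n) x) < \<delta>" for n using h(2)[OF xn] unfolding Ph dist_norm .
  have Pc: "\<bar>P n $ i - (f ^^ n) x $ i\<bar> < \<delta>" for n i
    using le_less_trans[OF component_le_norm_cart[of "P n - (f ^^ n) x" i] Pd] by simp
  have xB: "(f ^^ n) x \<in> Box" for n by (rule \<Lambda>_Box[OF xn])
  have Pbox: "P n \<in> box3 5 5 500" for n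
    using Pc[of n 1] Pc[of n 2] Pc[of n 3] xB[of n] \<delta> unfolding box3_def Box_def by auto
  have Qbox: "Q n \<in> box3 5 5 500" for n using q(2)[of n] unfolding Q_def strips_def box3_def by auto
  define b where "b n \<longleftrightarrow> 0 < Q n $ 2" for n
  have Qside: "side (b n) (Q n)" for n
    using q(2)[of n] unfolding b_def Q_def strips_def side_def by auto
  have Pside: "side (b n) (P n)" for n
  proof -
    have "0 < (f ^^ n) x $ 2 \<longleftrightarrow> b n" using xs[of "int n"] unfolding orb_nat b_def Q_def by simp
    then show ?thesis using Pc[of n 2] xB[of n] \<delta> unfolding side_def Box_def by auto
  qed
  have PS: "P (Suc n) = g (P n)" and QS: "Q (Suc n) = g (Q n)" for n by (simp_all add: P_def Q_def)
  note contract = same_itinerary_contracts[where g = g and P = Q and Q = P and b = b, OF g(1) QS Qbox PS Pbox Qside Pside]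
  obtain v where v: "v $ 1 = 0" "\<And>i. i < N \<Longrightarrow> 2 \<le> (f ^^ i) v $ 2" "dist q ((f ^^ N) v) \<le> \<eta>"
    using near[OF q(1)] by blast
  have past: "\<bar>(f ^^ N) v $ 1 - x $ 1\<bar> \<le> 4 / 6 ^ N + \<bar>(f ^^ N) v $ 2 - x $ 2\<bar> / 2"
    by (rule same_past_close[OF v(1,2) x]) (simp_all add: xs)
  have d: "\<bar>(Q 0 $ i - P 0 $ i) - ((f ^^ N) v $ i - x $ i)\<bar> \<le> \<eta> + \<delta>" for i
  proof -
    have "\<bar>q $ i - (f ^^ N) v $ i\<bar> \<le> \<eta>"
      using order.trans[OF component_le_norm_cart[of "q - (f ^^ N) v" i] v(3)[unfolded dist_norm]] by simp
    moreover have "\<bar>P 0 $ i - x $ i\<bar> < \<delta>" using Pc[of 0 i] by simp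
    ultimately show ?thesis by (simp add: Q_def)
  qed
  have dx: "\<bar>Q 0 $ 1 - P 0 $ 1\<bar> \<le> 2 * (4 / 6 ^ N) + 2 * (\<eta> + \<delta>)"
    by (rule small_cone_arithmetic[OF contract(1) d d past]) simp
  have est: "norm (Q n - P n) \<le> 102 * (8 / 6 ^ N + 2 * (\<eta> + \<delta>)) * (51 / 100) ^ n" for n
  proof -
    have "norm (Q n - P n) \<le> 102 * (51 / 100) ^ n * \<bar>Q 0 $ 1 - P 0 $ 1\<bar>" by (rule contract(3))
    also have "\<dots> \<le> 102 * (51 / 100) ^ n * (2 * (4 / 6 ^ N) + 2 * (\<eta> + \<delta>))"
      using dx by (intro mult_left_mono) auto
    finally show ?thesis by (simp add: algebra_simps)
  qed
  have QV: "Q n \<in> V" for n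
  proof (rule V[OF xn[of n]])
    have pos: "0 \<le> 102 * (8 / 6 ^ N + 2 * (\<eta> + \<delta>))" using order.trans[OF norm_ge_zero est[of 0]] by simp
    have "norm (Q n - P n) \<le> 102 * (8 / 6 ^ N + 2 * (\<eta> + \<delta>)) * 1"
      by (rule order.trans[OF est]) (intro mult_left_mono pos power_le_one, auto)
    moreover have "dist ((f ^^ n) x) (Q n) \<le> norm (Q n - P n) + norm (P n - (f ^^ n) x)"
      using norm_triangle_ineq[of "Q n - P n" "P n - (f ^^ n) x"] by (simp add: dist_norm norm_minus_commute)
    ultimately show "dist ((f ^^ n) x) (Q n) < \<rho>" using Pd[of n] small by linarith
  qed
  have "(\<lambda>n. norm (P n - Q n)) \<longlonglongrightarrow> 0"
  proof (rule Lim_null_comparison[rotated])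
    have "(\<lambda>n. 102 * (8 / 6 ^ N + 2 * (\<eta> + \<delta>)) * (51 / 100 :: real) ^ n) \<longlonglongrightarrow> 102 * (8 / 6 ^ N + 2 * (\<eta> + \<delta>)) * 0"
      by (intro tendsto_mult tendsto_const LIMSEQ_power_zero) simp
    then show "(\<lambda>n. 102 * (8 / 6 ^ N + 2 * (\<eta> + \<delta>)) * (51 / 100 :: real) ^ n) \<longlonglongrightarrow> 0" by simp
  qed (use est in \<open>simp add: norm_minus_commute\<close>)
  then have "q \<in> W_s_loc g V (h ` \<Lambda>)" unfolding W_s_loc_def using x QV by (auto simp: P_def Q_def)
  with q(1) show ?thesis by blast
qed

text \<open>Given \<open>V\<close>, which contains a \<open>\<rho>\<close>-neighbourhood of the horseshoe, the disks are those \<open>C\<^sup>1\<close>-close to the reference disk of order \<open>N\<close>, for \<open>N\<close> large.\<close>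
lemma blender_\<Lambda>: "k_blender TYPE(real) 2 f \<Lambda>"
  unfolding k_blender_def
proof (intro conjI allI impI f_diffeo hyperbolic_\<Lambda> transitive_\<Lambda>)
  show "\<exists>d\<^sub>s<2. stable_dim f \<Lambda> d\<^sub>s" using stable_dim_\<Lambda> by (intro exI[of _ 1]) simp
  fix V assume "open V \<and> \<Lambda> \<subseteq> V"
  then obtain \<rho> where \<rho>: "0 < \<rho>" "(\<Union>x\<in>\<Lambda>. ball x \<rho>) \<subseteq> V"
    using compact_subset_open_imp_ball_epsilon_subset[OF compact_\<Lambda>] by metis
  obtain N where N: "4000 / \<rho> < 6 ^ N" using real_arch_pow[of 6 "4000 / \<rho>"] by auto
  have N': "1 / 6 ^ N < \<rho> / 4000"
    using N \<rho>(1) by (simp add: field_simps)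
  obtain r :: real and \<gamma> w where r: "0 < r" and emb: "\<gamma> \<in> disk_embeddings"
    and ends: "\<gamma> (- 1) $ 2 = - (21 / 5)" "\<gamma> 1 $ 2 = 21 / 5"
    and cone: "\<And>s t. s \<in> {-1..1} \<Longrightarrow> t \<in> {-1..1} \<Longrightarrow> r * \<bar>t - s\<bar> \<le> \<bar>\<gamma> t $ 2 - \<gamma> s $ 2\<bar> \<and>
        \<bar>\<gamma> t $ 1 - \<gamma> s $ 1\<bar> \<le> 3 / 10 * \<bar>\<gamma> t $ 2 - \<gamma> s $ 2\<bar> \<and> \<bar>\<gamma> t $ 3 - \<gamma> s $ 3\<bar> \<le> 39 / 100 * \<bar>\<gamma> t $ 2 - \<gamma> s $ 2\<bar>"
    and \<gamma>x: "\<And>t. t \<in> {-1..1} \<Longrightarrow> \<bar>\<gamma> t $ 1\<bar> \<le> 21 / 5"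
    and \<gamma>z: "\<And>t. t \<in> {-1..1} \<Longrightarrow> \<gamma> t $ 2 = 0 \<Longrightarrow> \<gamma> t $ 3 = 0"
    and \<gamma>w: "\<And>t. \<gamma> t = (f ^^ N) (w t)" "\<And>t. w t $ 1 = 0"
    and w: "\<And>t i. t \<in> {-1..1} \<Longrightarrow> i < N \<Longrightarrow> 2 \<le> (f ^^ i) (w t) $ 2"
    by (rule reference_curve[of N]) (rule that)
  \<comment> \<open>fractions of \<open>\<rho>\<close> small enough to absorb the factor 102 of the contraction estimate\<close>
  define \<delta> where "\<delta> = min (1 / 20) (\<rho> / 4000)"
  define \<eta> where "\<eta> = min (min (1 / 10) (r / 1000)) (\<rho> / 4000)"
  \<comment> \<open>\<open>\<U>\<close> does not depend on \<open>V\<close>; only \<open>\<delta>\<close> and the disks do\<close>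
  define \<U> where "\<U> = {g \<in> diffeos. \<exists>e<1 / 1000000. C1_close UNIV (box3 5 5 500) e f g}"
  define \<S> where "\<S> = {S \<in> disk_embeddings. \<exists>e<\<eta>. C1_close (cball 0 1) (cball 0 1) e \<gamma> S}"
  have pos: "0 < \<delta>" "0 < \<eta>" using \<rho>(1) r by (auto simp: \<delta>_def \<eta>_def)
  have C1S: "C1_on (cball 0 1) S" if "S \<in> disk_embeddings" for S :: "real \<Rightarrow> real ^ 3"
    using that by (simp add: disk_embeddings_def)
  have ball: "cball 0 1 = {-1..1::real}" by (simp add: cball_eq_atLeastAtMost)
  have contS: "continuous_on {-1..1} S" if "S \<in> disk_embeddings" for S :: "real \<Rightarrow> real ^ 3"
    using C1_on_has_derivative[OF C1S[OF that]] has_derivative_continuous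
    unfolding ball continuous_on_eq_continuous_within by blast
  have U_open: "C1_open UNIV diffeos \<U>" unfolding \<U>_def
    by (rule C1_open_ball[OF compact_box3 subset_UNIV _ f_diffeo]) (simp add: diffeos_def)
  have fU: "f \<in> \<U>" unfolding \<U>_def using f_diffeo C1_close_refl[of "1 / 2000000"]
    by (auto intro!: exI[of _ "1 / 2000000"])
  have S_open: "C1_open (cball 0 1) disk_embeddings \<S>" unfolding \<S>_def
    by (rule C1_open_ball[OF compact_cball order_refl C1S emb])
  have S_ne: "\<S> \<noteq> {}" unfolding \<S>_def using emb C1_close_refl[of "\<eta> / 2"] pos(2)
    by (auto intro!: exI[of _ \<gamma>] exI[of _ "\<eta> / 2"])
  have meet: "S ` cball 0 1 \<inter> W_s_loc g V \<Lambda>g \<noteq> {}"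
    if g: "g \<in> \<U>" and cont: "hyperbolic_continuation \<delta> f \<Lambda> g \<Lambda>g" and S: "S \<in> \<S>" for g \<Lambda>g S
  proof -
    obtain h h' where hom: "homeomorphism \<Lambda> \<Lambda>g h h'"
      and h: "\<And>x. x \<in> \<Lambda> \<Longrightarrow> h (f x) = g (h x)" "\<And>x. x \<in> \<Lambda> \<Longrightarrow> dist (h x) x < \<delta>"
      using cont unfolding hyperbolic_continuation_def by blast
    have \<Lambda>g: "\<Lambda>g = h ` \<Lambda>" using hom by (simp add: homeomorphism_image1)
    obtain e0 where gd: "g \<in> diffeos" "e0 < 1 / 1000000" "C1_close UNIV (box3 5 5 500) e0 f g"
      using g unfolding \<U>_def by blast
    have g_near: "f_near g" by (rule C1_close_f_near[OF gd])
    have g_cont: "continuous_on UNIV g"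
      using C1_on_has_derivative[of UNIV g] gd(1) has_derivative_continuous
      unfolding diffeos_def continuous_on_eq_continuous_within by blast
    obtain e where Sd: "S \<in> disk_embeddings" and e: "e < \<eta>" "C1_close {-1..1} {-1..1} e \<gamma> S"
      using S unfolding \<S>_def ball by blast
    have close: "norm (\<gamma> t - S t) \<le> \<eta>" if "t \<in> {-1..1}" for t
      using e that unfolding C1_close_def by force
    have lip: "norm ((\<gamma> s - S s) - (\<gamma> t - S t)) \<le> r / 1000 * \<bar>s - t\<bar>" if "s \<in> {-1..1}" "t \<in> {-1..1}" for s t
    proof -
      have "norm ((\<gamma> s - S s) - (\<gamma> t - S t)) \<le> e * norm (s - t)"
        by (rule C1_close_lipschitz[OF e(2) _ order_refl C1S[OF emb, unfolded ball] C1S[OF Sd, unfolded ball] that]) simp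
      also have "\<dots> \<le> r / 1000 * norm (s - t)" using e(1) by (intro mult_right_mono) (auto simp: \<eta>_def)
      finally show ?thesis by simp
    qed
    define C where "C = {p \<in> S ` {-1..1}. \<bar>p $ 2\<bar> \<le> 4}"
    have adm: "admissible C" unfolding C_def
      by (rule admissible_perturbed_curve[OF r ends cone \<gamma>x \<gamma>z contS[OF emb] contS[OF Sd] _ lip])
        (use close \<eta>_def in force)+
    have comp: "compact C"
    proof -
      have "C = S ` {-1..1} \<inter> {p. \<bar>p $ 2\<bar> \<le> 4}" unfolding C_def by auto
      then show ?thesis
        using compact_Int_closed[OF compact_continuous_image[OF contS[OF Sd] compact_Icc] closed_abs_le_nth(1)] by simp
    qed
    have near: "\<exists>v. v $ 1 = 0 \<and> (\<forall>i<N. 2 \<le> (f ^^ i) v $ 2) \<and> dist q ((f ^^ N) v) \<le> \<eta>" if qC: "q \<in> C" for q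
    proof -
      obtain t where t: "t \<in> {-1..1}" "q = S t" using qC unfolding C_def by auto
      then show ?thesis using \<gamma>w w[OF t(1)] close[OF t(1)]
        by (intro exI[of _ "w t"]) (simp add: dist_norm norm_minus_commute)
    qed
    have small: "102 * (8 / 6 ^ N + 2 * (\<eta> + \<delta>)) + \<delta> \<le> \<rho>"
    proof -
      have "8 / 6 ^ N \<le> 8 * (\<rho> / 4000)" using N' by simp
      moreover have "\<eta> \<le> \<rho> / 4000" "\<delta> \<le> \<rho> / 4000" by (auto simp: \<eta>_def \<delta>_def)
      ultimately show ?thesis using \<rho>(1) by argo
    qed
    have "C \<inter> W_s_loc g V (h ` \<Lambda>) \<noteq> {}"
    proof (rule blender_intersection[OF g_near g_cont h _ adm comp near small])
      show "\<delta> \<le> 1 / 20" by (simp add: \<delta>_def)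
      show "y \<in> V" if "x \<in> \<Lambda>" "dist x y < \<rho>" for x y
      proof -
        have "y \<in> ball x \<rho>" using that(2) by simp
        then show ?thesis using \<rho>(2) that(1) by blast
      qed
    qed
    then show ?thesis unfolding \<Lambda>g ball C_def by blast
  qed
  show "\<exists>\<delta>>0. \<exists>\<U> \<S>. C1_open UNIV diffeos \<U> \<and> f \<in> \<U> \<and>
      C1_open (cball 0 1) disk_embeddings \<S> \<and> \<S> \<noteq> {} \<and>
      (\<forall>g\<in>\<U>. \<forall>\<Lambda>g. hyperbolic_continuation \<delta> f \<Lambda> g \<Lambda>g \<longrightarrow>
        (\<forall>S\<in>\<S>. (S :: real \<Rightarrow> real ^ 3) ` cball 0 1 \<inter> W_s_loc g V \<Lambda>g \<noteq> {}))"
    using pos(1) U_open fU S_open S_ne meet by blast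
qed simp

end

theorem theorem5:
  fixes \<xi> :: real
  assumes "1.01 \<le> \<xi>" and "\<xi> \<le> 1.125"
  shows "\<exists>\<Lambda>. k_blender TYPE(real) 2 (henon_like (-9.5) 0.3 \<xi>) \<Lambda>"
proof -
  interpret henon \<xi> by unfold_locales (use assms in simp_all)
  show ?thesis using blender_\<Lambda> unfolding f_def by blast
qed

end
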